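(* Let $0 < \kappa < 1$ and let $P_\kappa = \wp(\,\cdot\,; G_2, G_3)$ with $G_2 = 48(1 + 8\kappa^2)$ and $G_3 = 64(1 - 20\kappa^2 - 8\kappa^4)$. The period lattice of $P_\kappa$ is rectangular, generated by $2\Omega_\kappa$ and $2\Omega_\kappa'$ with $\Omega_\kappa > 0$ real and $\Omega_\kappa'$ purely imaginary with positive imaginary part. Then $$\Omega_\kappa = \tfrac{1}{2\sqrt6}\, \pi \,_2F_1 (\tfrac{1}{3}, \tfrac{2}{3}; 1; \kappa^2).$$
   Context: $\wp(\,\cdot\,; g_2, g_3)$ denotes the Weierstrass elliptic function with invariants $g_2, g_3$; $\,_2F_1$ is the Gauss hypergeometric function. *)

theory Defs
  imports "HOL-Analysis.Analysis"
begin

definition lattice :: "complex \<Rightarrow> complex \<Rightarrow> complex set" where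
  "lattice w1 w2 = {of_int m * w1 + of_int n * w2 | m n :: int. True}"

definition lattice_g2 :: "complex set \<Rightarrow> complex" where
  "lattice_g2 L = 60 * infsum (\<lambda>w. 1 / w ^ 4) (L - {0})"

definition lattice_g3 :: "complex set \<Rightarrow> complex" where
  "lattice_g3 L = 140 * infsum (\<lambda>w. 1 / w ^ 6) (L - {0})"

definition weierstrass_p :: "complex set \<Rightarrow> complex \<Rightarrow> complex" where
  "weierstrass_p L z = 1 / z ^ 2 + infsum (\<lambda>w. 1 / (z - w) ^ 2 - 1 / w ^ 2) (L - {0})"

definition hyp2F1 :: "real \<Rightarrow> real \<Rightarrow> real \<Rightarrow> real \<Rightarrow> real" where
  "hyp2F1 a b c x =
     (\<Sum>n. pochhammer a n * pochhammer b n / (pochhammer c n * fact n) * x ^ n)"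

end

theory Submission
  imports Defs "HOL-Complex_Analysis.Complex_Analysis"
begin

text \<open>
  Write K(a, b) for the integral of 1 / sqrt ((s^2 + a) (s^2 + b)) over s > 0. The Weierstrass
  function of the lattice generated by 2A and 2iB takes three distinct real values e1 > e2 > e3 at
  the half-periods and decreases from infinity to e1 on (0, A]; integrating its differential
  equation gives A = K(e1 - e2, e1 - e3). The same argument for the lattice rotated by a right
  angle gives B = K(e2 - e3, e1 - e3).

  Put v = sin^2 (t / 3) with sin t = \<kappa> sin p, and let
  X = 2 \<kappa>^2 / (3 v) - 2 + 32 v - 128 v^2 / 3. When p runs from 0 to pi / 2, X decreases from infinity
  to the largest root of 4 x^3 - G2 x - G3, and
  dX / sqrt (4 X^3 - G2 X - G3) = - cos (t / 3) / cos t dp / sqrt 6.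
  Since cos (t / 3) / cos t is the hypergeometric function F(1/3, 2/3; 1/2; .) at sin^2 t, integrating
  its power series term by term against Wallis' integrals turns 1/2 into 1 and yields
  A = pi / (2 sqrt 6) F(1/3, 2/3; 1; \<kappa>^2).

  For existence, take the roots e1 > e2 > e3 of 4 x^3 - G2 x - G3 and the rectangular lattice with
  A = K(e1 - e2, e1 - e3) and B = K(e2 - e3, e1 - e3). Its own half-period values have the same two
  integrals; as K is homogeneous and strictly decreasing in its first argument, the pair
  (K(a, b), K(b - a, b)) determines (a, b), so these values are e1, e2, e3.
\<close>

section \<open>Complete elliptic integrals\<close>

text \<open>The curve behind X is y^2 = v (\<kappa>^2 - v (3 - 4 v)^2). By the triple-angle formula
  v (3 - 4 v)^2 = sin^2 t, so with sin t = \<kappa> sin p the bracket is the square of \<kappa> cos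
  p, and dv / y becomes the elementary form (2/3) cos (t / 3) / cos t dp. The rational function X of
  v carries this differential to the curve with invariants G2 and G3. The claim concerns every
  rectangular lattice with these invariants, so the order of the half-period values, and the root at
  which each substitution ends, have to be established. Both come from one criterion,
  \<open>complete_period_eqI\<close>: a function that falls from infinity to one of three distinct
  roots while satisfying the differential equation can only end at the largest root. It serves the
  Weierstrass function and X alike, and it replaces a change of variables in an improper integral by
  a function with zero derivative. The elliptic function theory rests on Liouville's theorem and on
  uniqueness for y'' = 6 y^2 - g2 / 2; the latter gives injectivity up to sign without counting
  zeros.\<close>

text \<open>The substitution x = e1 + s^2 turns the integral of 1 / sqrt (4 (x - e1) (x - e2) (x - e3))
  over x > e1 into the integral of 1 / sqrt ((s^2 + a) (s^2 + b)) over s > 0 with a = e1 - e2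
  and b = e1 - e3.\<close>

definition incomplete_period :: "real \<Rightarrow> real \<Rightarrow> real \<Rightarrow> real" where
  "incomplete_period a b s = integral {0..s} (\<lambda>t. 1 / sqrt ((t\<^sup>2 + a) * (t\<^sup>2 + b)))"

text \<open>The improper integral is encoded as a supremum: for positive a and b the proper
  integrals increase with s and are bounded, so the supremum is also their limit at
  infinity.\<close>

definition complete_period :: "real \<Rightarrow> real \<Rightarrow> real" where
  "complete_period a b = (SUP s\<in>{0..}. incomplete_period a b s)"

lemma period_integrand_continuous:
  assumes "0 < a" "0 < b"
  shows "continuous_on S (\<lambda>t::real. 1 / sqrt ((t\<^sup>2 + a) * (t\<^sup>2 + b)))"
proof (intro continuous_intros ballI)
  fix t :: real
  have "t\<^sup>2 + a > 0" "t\<^sup>2 + b > 0" using assms by (simp_all add: add_nonneg_pos)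
  then show "sqrt ((t\<^sup>2 + a) * (t\<^sup>2 + b)) \<noteq> 0" by simp
qed

lemma incomplete_period_deriv_within:
  assumes "0 < a" "0 < b" "0 \<le> s" "s \<le> u"
  shows "(incomplete_period a b has_real_derivative 1 / sqrt ((s\<^sup>2 + a) * (s\<^sup>2 + b))) (at s within {0..u})"
  using integral_has_real_derivative[OF period_integrand_continuous[OF assms(1,2), of "{0..u}"], of s] assms(3,4)
  unfolding incomplete_period_def[abs_def] by auto

lemma incomplete_period_deriv:
  assumes "0 < a" "0 < b" "0 < s"
  shows "(incomplete_period a b has_real_derivative 1 / sqrt ((s\<^sup>2 + a) * (s\<^sup>2 + b))) (at s)"
proof -
  have "at s within {0..s+1} = at s"
    using assms(3) by (intro at_within_interior) auto
  then show ?thesis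
    using incomplete_period_deriv_within[OF assms(1,2), of s "s+1"] assms(3) by simp
qed

lemma incomplete_period_continuous:
  assumes "0 < a" "0 < b"
  shows "continuous_on {0..u} (incomplete_period a b)"
  by (rule DERIV_continuous_on[OF incomplete_period_deriv_within[OF assms]]) auto

lemma incomplete_period_0 [simp]: "incomplete_period a b 0 = 0"
  by (simp add: incomplete_period_def)

lemma incomplete_period_mono:
  assumes "0 < a" "0 < b" "0 \<le> s" "s \<le> t"
  shows "incomplete_period a b s \<le> incomplete_period a b t"
proof (rule DERIV_nonneg_imp_increasing_open[OF assms(4)])
  show "continuous_on {s..t} (incomplete_period a b)"
    using incomplete_period_continuous[OF assms(1,2), of t] by (rule continuous_on_subset) (use assms in auto)
  show "\<exists>y. (incomplete_period a b has_real_derivative y) (at x) \<and> 0 \<le> y" if "s < x" "x < t" for x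
    by (rule exI, rule conjI, rule incomplete_period_deriv) (use assms that in auto)
qed

text \<open>Comparison with C / (1 + t^2), whose integral is C arctan s. The constant satisfies C
  \<ge> 1 and C min(a, b) \<ge> 1, hence 1 + t^2 \<le> C (t^2 + min(a, b)).\<close>

lemma incomplete_period_le:
  assumes "0 < a" "0 < b" "0 \<le> s"
  shows "incomplete_period a b s \<le> max 1 (1 / min a b) * (pi / 2)"
proof -
  define C where "C = max 1 (1 / min a b)"
  have C: "C \<ge> 1" "C * min a b \<ge> 1"
    using assms by (auto simp: C_def max_def field_simps min_def split: if_splits)
  have "integral {0..s} (\<lambda>t. 1 / sqrt ((t\<^sup>2 + a) * (t\<^sup>2 + b))) \<le> integral {0..s} (\<lambda>t. C * (1 / (1 + t\<^sup>2)))"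
  proof (rule integral_le)
    show "(\<lambda>t. 1 / sqrt ((t\<^sup>2 + a) * (t\<^sup>2 + b))) integrable_on {0..s}"
      by (intro integrable_continuous_real period_integrand_continuous assms)
    show "(\<lambda>t. C * (1 / (1 + t\<^sup>2))) integrable_on {0..s}"
      by (intro integrable_continuous_real continuous_intros) (auto simp: add_nonneg_eq_0_iff)
    fix t :: real
    have "(1 + t\<^sup>2) \<le> C * (t\<^sup>2 + min a b)"
      using C mult_right_mono[of 1 C "t\<^sup>2"] by (simp add: algebra_simps)
    also have "t\<^sup>2 + min a b \<le> sqrt ((t\<^sup>2 + a) * (t\<^sup>2 + b))"
      using assms by (intro real_le_rsqrt) (auto simp: power2_eq_square intro!: mult_mono)
    finally have le: "1 + t\<^sup>2 \<le> C * sqrt ((t\<^sup>2 + a) * (t\<^sup>2 + b))"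
      using C by simp
    have "0 < sqrt ((t\<^sup>2 + a) * (t\<^sup>2 + b))"
      using assms by (simp add: add_nonneg_pos)
    then show "1 / sqrt ((t\<^sup>2 + a) * (t\<^sup>2 + b)) \<le> C * (1 / (1 + t\<^sup>2))"
      using le by (simp add: field_simps add_pos_nonneg)
  qed
  also have "((\<lambda>t. C * (1 / (1 + t\<^sup>2))) has_integral (C * arctan s - C * arctan 0)) {0..s}"
    by (rule fundamental_theorem_of_calculus[OF assms(3)])
       (auto intro!: derivative_eq_intros simp: has_real_derivative_iff_has_vector_derivative[symmetric] field_simps)
  then have "integral {0..s} (\<lambda>t. C * (1 / (1 + t\<^sup>2))) = C * arctan s"
    by (simp add: integral_unique)
  also have "\<dots> \<le> C * (pi / 2)"
    using C arctan_ubound[of s] by (intro mult_left_mono) auto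
  finally show ?thesis by (simp add: incomplete_period_def C_def)
qed

lemma incomplete_period_tendsto:
  assumes "0 < a" "0 < b"
  shows "(incomplete_period a b \<longlongrightarrow> complete_period a b) at_top"
proof (rule increasing_tendsto)
  have bdd: "bdd_above (incomplete_period a b ` {0..})"
    by (rule bdd_aboveI2[OF incomplete_period_le[OF assms]]) simp
  show "\<forall>\<^sub>F n in at_top. incomplete_period a b n \<le> complete_period a b"
    unfolding complete_period_def
    by (intro eventually_at_top_linorderI[of 0] cSUP_upper bdd) auto
  fix x assume "x < complete_period a b"
  then obtain s where "0 \<le> s" "x < incomplete_period a b s"
    unfolding complete_period_def by (subst (asm) less_cSUP_iff[OF _ bdd]) auto
  then show "\<forall>\<^sub>F n in at_top. x < incomplete_period a b n"
    by (intro eventually_at_top_linorderI[of s]) (use incomplete_period_mono[OF assms] in force)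
qed

lemma incomplete_period_scale:
  assumes "0 < a" "0 < b" "0 < c" "0 \<le> s"
  shows "incomplete_period (c\<^sup>2 * a) (c\<^sup>2 * b) (c * s) = incomplete_period a b s / c"
proof (cases "s = 0")
  case False
  then have s: "0 < s" using assms by simp
  define F where "F x = incomplete_period (c\<^sup>2 * a) (c\<^sup>2 * b) (c * x) - incomplete_period a b x / c" for x
  have pos: "0 < c\<^sup>2 * a" "0 < c\<^sup>2 * b" using assms by simp_all
  have "F s = F 0"
  proof (rule DERIV_isconst_end[OF s])
    show "continuous_on {0..s} F"
      unfolding F_def using assms
      by (intro continuous_intros incomplete_period_continuous
          continuous_on_compose2[OF incomplete_period_continuous[OF pos, of "c * s"]]) auto
    fix x assume x: "0 < x" "x < s"
    have sq: "sqrt (((c * x)\<^sup>2 + c\<^sup>2 * a) * ((c * x)\<^sup>2 + c\<^sup>2 * b)) = c\<^sup>2 * sqrt ((x\<^sup>2 + a) * (x\<^sup>2 + b))"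
    proof -
      have "((c * x)\<^sup>2 + c\<^sup>2 * a) * ((c * x)\<^sup>2 + c\<^sup>2 * b) = (c\<^sup>2)\<^sup>2 * ((x\<^sup>2 + a) * (x\<^sup>2 + b))"
        by (simp add: algebra_simps power2_eq_square)
      then show ?thesis by (simp only: real_sqrt_mult real_sqrt_abs) simp
    qed
    have "((\<lambda>x. incomplete_period (c\<^sup>2 * a) (c\<^sup>2 * b) (c * x)) has_real_derivative
            1 / sqrt (((c * x)\<^sup>2 + c\<^sup>2 * a) * ((c * x)\<^sup>2 + c\<^sup>2 * b)) * c) (at x)"
      by (rule DERIV_chain2[OF incomplete_period_deriv[OF pos]])
         (use x assms in \<open>auto intro!: derivative_eq_intros\<close>)
    then have "(F has_real_derivative
        (1 / sqrt (((c * x)\<^sup>2 + c\<^sup>2 * a) * ((c * x)\<^sup>2 + c\<^sup>2 * b)) * c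
          - 1 / sqrt ((x\<^sup>2 + a) * (x\<^sup>2 + b)) / c)) (at x)"
      unfolding F_def by (intro DERIV_diff DERIV_cdivide incomplete_period_deriv assms x)
    then show "(F has_real_derivative 0) (at x)"
      unfolding sq using assms by (simp add: power2_eq_square)
  qed
  then show ?thesis by (simp add: F_def)
qed simp

lemma complete_period_scale:
  assumes "0 < a" "0 < b" "0 < c"
  shows "complete_period (c\<^sup>2 * a) (c\<^sup>2 * b) = complete_period a b / c"
proof (rule tendsto_unique[of at_top])
  show "((\<lambda>s. incomplete_period a b s / c) \<longlongrightarrow> complete_period a b / c) at_top"
    by (intro tendsto_intros incomplete_period_tendsto assms) (use assms in auto)
  have "filterlim (\<lambda>s. c * s) at_top at_top"
    using assms(3) by (simp add: filterlim_tendsto_pos_mult_at_top[OF tendsto_const] filterlim_ident)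
  then have "((\<lambda>s. incomplete_period (c\<^sup>2 * a) (c\<^sup>2 * b) (c * s)) \<longlongrightarrow> complete_period (c\<^sup>2 * a) (c\<^sup>2 * b)) at_top"
    using assms by (intro filterlim_compose[OF incomplete_period_tendsto]) auto
  then show "((\<lambda>s. incomplete_period a b s / c) \<longlongrightarrow> complete_period (c\<^sup>2 * a) (c\<^sup>2 * b)) at_top"
    by (rule Lim_transform_eventually)
       (auto intro!: eventually_at_top_linorderI[of 0] incomplete_period_scale assms)
qed auto

lemma complete_period_pos:
  assumes "0 < a" "0 < b"
  shows "0 < complete_period a b"
proof -
  have "incomplete_period a b 0 < incomplete_period a b 1"
  proof (rule DERIV_pos_imp_increasing_open[where f = "incomplete_period a b"])
    show "\<exists>y. (incomplete_period a b has_real_derivative y) (at x) \<and> y > 0" if "0 < x" "x < 1" for x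
      by (rule exI, rule conjI, rule incomplete_period_deriv) (use assms that in \<open>auto simp: add_nonneg_pos\<close>)
  qed (use incomplete_period_continuous[OF assms] in auto)
  also have "incomplete_period a b 1 \<le> complete_period a b"
    by (rule tendsto_lowerbound[OF incomplete_period_tendsto[OF assms]])
       (auto intro!: eventually_at_top_linorderI[of 1] incomplete_period_mono assms)
  finally show ?thesis by simp
qed

text \<open>The difference of the incomplete integrals is strictly increasing from 0. Its limit is
  therefore at least its value at 1, which is positive; this keeps the inequality strict in the
  limit.\<close>

lemma complete_period_strict_antimono:
  assumes "0 < a" "a < a'" "0 < b"
  shows "complete_period a' b < complete_period a b"
proof -
  define F where "F s = incomplete_period a b s - incomplete_period a' b s" for s
  have a': "0 < a'" using assms by simp
  have mono: "F s < F t" if st: "0 \<le> s" "s < t" for s t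
  proof (rule DERIV_pos_imp_increasing_open[OF st(2)])
    fix x assume x: "s < x" "x < t"
    have "(F has_real_derivative (1 / sqrt ((x\<^sup>2 + a) * (x\<^sup>2 + b)) - 1 / sqrt ((x\<^sup>2 + a') * (x\<^sup>2 + b)))) (at x)"
      unfolding F_def using x st by (intro DERIV_diff incomplete_period_deriv assms a') auto
    moreover have "1 / sqrt ((x\<^sup>2 + a) * (x\<^sup>2 + b)) > 1 / sqrt ((x\<^sup>2 + a') * (x\<^sup>2 + b))"
      using assms a' by (intro divide_strict_left_mono) (auto simp: add_nonneg_pos)
    ultimately show "\<exists>y. (F has_real_derivative y) (at x) \<and> 0 < y" by auto
  next
    have "continuous_on {0..t} F"
      unfolding F_def by (intro continuous_intros incomplete_period_continuous assms a')
    then show "continuous_on {s..t} F"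
      by (rule continuous_on_subset) (use st in auto)
  qed
  have "(F \<longlongrightarrow> complete_period a b - complete_period a' b) at_top"
    unfolding F_def by (intro tendsto_diff incomplete_period_tendsto assms a')
  then have "F 1 \<le> complete_period a b - complete_period a' b"
    by (rule tendsto_lowerbound)
       (auto intro!: eventually_at_top_linorderI[of 1] simp: le_less mono)
  moreover have "F 0 < F 1" by (rule mono) auto
  ultimately show ?thesis by (simp add: F_def)
qed

section \<open>Recovering the parameters from a pair of complete periods\<close>

lemma complete_period_normalize:
  assumes "0 < a" "0 < b"
  shows "complete_period a b = complete_period (a / b) 1 / sqrt b"
  using complete_period_scale[of "a / b" 1 "sqrt b"] assms by simp

text \<open>After scaling b to 1, the two integrals have the complementary parameters a / b and 1 -
  a / b. If a / b were smaller than a' / b', monotonicity would make the first equation force b' < b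
  and the second force b < b'.\<close>

lemma complete_period_pair_ratio_le:
  assumes "0 < a" "a < b" "0 < a'" "a' < b'"
    and 1: "complete_period a b = complete_period a' b'"
    and 2: "complete_period (b - a) b = complete_period (b' - a') b'"
  shows "a' / b' \<le> a / b"
proof (rule ccontr)
  assume "\<not> ?thesis"
  then have lt: "a / b < a' / b'" by simp
  have pos: "0 < a / b" "a / b < 1" "a' / b' < 1" "0 < b" "0 < b'" using assms by auto
  have eq: "(b - a) / b = 1 - a / b" "(b' - a') / b' = 1 - a' / b'"
    using pos by (simp_all add: field_simps)
  have n1: "complete_period (a / b) 1 / sqrt b = complete_period (a' / b') 1 / sqrt b'"
    using 1 assms complete_period_normalize[of a b] complete_period_normalize[of a' b'] by simp
  have n2: "complete_period (1 - a / b) 1 / sqrt b = complete_period (1 - a' / b') 1 / sqrt b'"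
    using 2 assms complete_period_normalize[of "b - a" b] complete_period_normalize[of "b' - a'" b']
    by (simp add: eq)
  have l1: "complete_period (a' / b') 1 < complete_period (a / b) 1"
    by (rule complete_period_strict_antimono) (use lt pos in auto)
  have l2: "complete_period (1 - a / b) 1 < complete_period (1 - a' / b') 1"
    by (rule complete_period_strict_antimono) (use lt pos in auto)
  have p: "0 < complete_period (a' / b') 1" "0 < complete_period (1 - a / b) 1"
    using lt pos by (auto intro!: complete_period_pos)
  have "sqrt b' < sqrt b"
  proof (rule ccontr)
    assume "\<not> sqrt b' < sqrt b"
    then have "complete_period (a' / b') 1 / sqrt b' \<le> complete_period (a' / b') 1 / sqrt b"
      using pos p by (intro divide_left_mono) auto
    also have "\<dots> < complete_period (a / b) 1 / sqrt b"
      using l1 pos by (simp add: divide_strict_right_mono)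
    finally show False using n1 by simp
  qed
  then have "complete_period (1 - a / b) 1 / sqrt b \<le> complete_period (1 - a / b) 1 / sqrt b'"
    using pos p by (intro divide_left_mono) auto
  also have "\<dots> < complete_period (1 - a' / b') 1 / sqrt b'"
    using l2 pos by (simp add: divide_strict_right_mono)
  finally show False using n2 by simp
qed

lemma complete_period_pair_inj:
  assumes "0 < a" "a < b" "0 < a'" "a' < b'"
    and 1: "complete_period a b = complete_period a' b'"
    and 2: "complete_period (b - a) b = complete_period (b' - a') b'"
  shows "a = a'" "b = b'"
proof -
  have r: "a / b = a' / b'"
    using complete_period_pair_ratio_le[OF assms]
      complete_period_pair_ratio_le[OF assms(3,4,1,2) 1[symmetric] 2[symmetric]] by simp
  have "complete_period (a / b) 1 / sqrt b = complete_period (a / b) 1 / sqrt b'"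
    using 1 assms complete_period_normalize[of a b] complete_period_normalize[of a' b'] r by simp
  moreover have "0 < complete_period (a / b) 1"
    using assms by (intro complete_period_pos) auto
  ultimately show "b = b'" using assms by (simp add: field_simps)
  with r show "a = a'" using assms by simp
qed

text \<open>With S = sqrt (X - l), the differential equation says that the incomplete period at S
  plus G has derivative 0; comparing its limits at the two ends of the interval gives the value. For
  the Weierstrass function g is 1 and G is the identity; for the trigonometric parametrisation g is
  the hypergeometric integrand.\<close>

lemma complete_period_eqI:
  fixes X D g G :: "real \<Rightarrow> real"
  assumes c: "0 < c"
    and X: "\<And>t. 0 < t \<Longrightarrow> t < c \<Longrightarrow> (X has_real_derivative D t) (at t)"
    and D: "\<And>t. 0 < t \<Longrightarrow> t < c \<Longrightarrow> D t < 0"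
    and ode: "\<And>t. 0 < t \<Longrightarrow> t < c \<Longrightarrow> (D t)\<^sup>2 = (g t)\<^sup>2 * (4 * (X t - l) * (X t - r) * (X t - s))"
    and g: "\<And>t. 0 < t \<Longrightarrow> t < c \<Longrightarrow> 0 < g t"
    and G: "\<And>t. 0 < t \<Longrightarrow> t < c \<Longrightarrow> (G has_real_derivative g t) (at t)"
    and contG: "continuous_on {0..c} G"
    and lim0: "filterlim X at_top (at_right 0)" and limc: "(X \<longlongrightarrow> l) (at_left c)"
    and ne: "l \<noteq> r" "l \<noteq> s"
  shows "r < l" "s < l" "complete_period (l - r) (l - s) = G c - G 0"
proof -
  have decr: "X t < X u" if "0 < u" "u < t" "t < c" for t u
    by (rule DERIV_neg_imp_decreasing[OF that(2)]) (use that X D in force)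
  have gt: "l < X t" if t: "0 < t" "t < c" for t
  proof -
    define m where "m = (t + c) / 2"
    have m: "t < m" "m < c" using t by (auto simp: m_def)
    have "l \<le> X m"
    proof (rule tendsto_upperbound[OF limc])
      show "\<forall>\<^sub>F i in at_left c. X i \<le> X m"
        using m t by (auto simp: eventually_at_left_field intro!: exI[of _ m] less_imp_le decr)
    qed auto
    also have "X m < X t" by (rule decr) (use m t in auto)
    finally show ?thesis .
  qed
  have surj: "\<exists>t. 0 < t \<and> t < c \<and> X t = y" if y: "l < y" for y
  proof -
    have "\<forall>\<^sub>F t in at_right 0. y \<le> X t \<and> t \<in> {0<..<c}"
      using filterlim_at_top[THEN iffD1, OF lim0, rule_format, of y] eventually_at_right_real[OF c]
      by eventually_elim auto
    then obtain t1 where t1: "y \<le> X t1" "0 < t1" "t1 < c"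
      using eventually_happens'[of "at_right (0::real)"] by force
    have "\<forall>\<^sub>F t in at_left c. X t < y \<and> t \<in> {t1<..<c}"
      using order_tendstoD(2)[OF limc y] eventually_at_left_real[OF t1(3)]
      by eventually_elim auto
    then obtain t2 where t2: "X t2 < y" "t1 < t2" "t2 < c"
      using eventually_happens'[of "at_left c"] by force
    have "\<exists>t\<ge>t1. t \<le> t2 \<and> X t = y"
    proof (rule IVT2)
      show "\<forall>x. t1 \<le> x \<and> x \<le> t2 \<longrightarrow> isCont X x"
        using t1 t2 by (auto intro!: DERIV_isCont X)
    qed (use t1 t2 in auto)
    then show ?thesis using t1 t2 by (metis le_less_trans less_le_trans)
  qed
  \<comment> \<open>Every y > l is a value of X, and the slope there is nonzero, so the cubic is
    positive at y. A root r or s above l would contradict this at y = r or y = s.\<close>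
  have pos: "0 < (y - r) * (y - s)" if y: "l < y" for y
  proof -
    obtain t where t: "0 < t" "t < c" "X t = y" using surj[OF y] by auto
    have "0 < (D t)\<^sup>2" using D[OF t(1,2)] by simp
    then have "0 < (g t)\<^sup>2 * (4 * (y - l)) * ((y - r) * (y - s))"
      using ode[OF t(1,2)] t(3) by (simp add: mult_ac)
    moreover have "0 < (g t)\<^sup>2 * (4 * (y - l))" using g[OF t(1,2)] y by simp
    ultimately show ?thesis by (rule zero_less_mult_pos)
  qed
  show rl: "r < l" using pos[of r] ne by force
  show sl: "s < l" using pos[of s] ne by force
  define a where "a = l - r"
  define b where "b = l - s"
  have ab: "0 < a" "0 < b" using rl sl by (simp_all add: a_def b_def)
  define S where "S t = sqrt (X t - l)" for t
  define F where "F t = incomplete_period a b (S t) + G t" for t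
  have S: "0 < S t" "(S t)\<^sup>2 = X t - l" if "0 < t" "t < c" for t
    using gt[OF that] by (simp_all add: S_def)
  have dF: "(F has_real_derivative 0) (at t)" if t: "0 < t" "t < c" for t
  proof -
    define Q where "Q = sqrt (((S t)\<^sup>2 + a) * ((S t)\<^sup>2 + b))"
    have Qpos: "0 < Q" unfolding Q_def using ab by (simp add: add_nonneg_pos)
    have Q2: "Q\<^sup>2 = (X t - r) * (X t - s)"
      using pos[OF gt[OF t]] unfolding Q_def S(2)[OF t] a_def b_def by simp
    have "(D t)\<^sup>2 = (2 * g t * S t * Q)\<^sup>2"
      unfolding power_mult_distrib Q2 S(2)[OF t] ode[OF t] by simp
    moreover have "0 \<le> 2 * g t * S t * Q" using g[OF t] S[OF t] Qpos by simp
    ultimately have Dt: "D t = - (2 * g t * S t * Q)"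
      using D[OF t] by (auto simp: power2_eq_iff)
    have dS: "(S has_real_derivative D t / (2 * S t)) (at t)"
      unfolding S_def using gt[OF t] X[OF t]
      by (auto intro!: derivative_eq_intros simp: field_simps)
    have "(F has_real_derivative 1 / Q * (D t / (2 * S t)) + g t) (at t)"
      unfolding F_def Q_def
      by (intro DERIV_add DERIV_chain2[OF incomplete_period_deriv[OF ab S(1)[OF t]] dS] G t)
    then show ?thesis
      using Qpos S(1)[OF t] by (simp add: Dt field_simps)
  qed
  \<comment> \<open>Constancy is used on the open interval only: X is unbounded at 0, and S is a
    square root that reaches 0 at c. The end values enter through one-sided limits.\<close>
  have Fconst: "F t = F (c / 2)" if t: "0 < t" "t < c" for t
    by (rule DERIV_isconst3[where a = 0 and b = c]) (use t c dF in auto)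
  have ev0: "\<forall>\<^sub>F t in at_right 0. F t = F (c / 2)"
    using eventually_at_right_real[OF c] by eventually_elim (rule Fconst, auto)
  have evc: "\<forall>\<^sub>F t in at_left c. F t = F (c / 2)"
    using eventually_at_left_real[OF c] by eventually_elim (rule Fconst, auto)
  have "filterlim S at_top (at_right 0)"
    unfolding S_def
    by (rule filterlim_compose[OF sqrt_at_top])
       (use filterlim_tendsto_add_at_top[OF tendsto_const[of "- l"] lim0] in simp)
  then have "((\<lambda>t. incomplete_period a b (S t)) \<longlongrightarrow> complete_period a b) (at_right 0)"
    by (rule filterlim_compose[OF incomplete_period_tendsto[OF ab]])
  moreover have "(G \<longlongrightarrow> G 0) (at_right 0)"
    using continuous_on_Icc_at_rightD[OF contG c] .
  ultimately have "(F \<longlongrightarrow> complete_period a b + G 0) (at_right 0)"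
    unfolding F_def by (rule tendsto_add)
  then have e0: "complete_period a b + G 0 = F (c / 2)"
    using tendsto_unique[OF _ _ tendsto_eventually[OF ev0]] by (auto simp: trivial_limit_at_right_real)
  have "((\<lambda>t. S t) \<longlongrightarrow> sqrt (l - l)) (at_left c)"
    unfolding S_def by (intro tendsto_intros limc)
  then have "(S \<longlongrightarrow> 0) (at_left c)" by simp
  then have "((\<lambda>t. incomplete_period a b (S t)) \<longlongrightarrow> incomplete_period a b 0) (at_left c)"
  proof (rule continuous_on_tendsto_compose[OF incomplete_period_continuous[OF ab, of 1]])
    show "\<forall>\<^sub>F t in at_left c. S t \<in> {0..1}"
      using order_tendstoD(2)[OF \<open>(S \<longlongrightarrow> 0) (at_left c)\<close> zero_less_one] eventually_at_left_real[OF c]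
      by eventually_elim (use S(1) in \<open>auto simp: less_imp_le\<close>)
  qed auto
  moreover have "(G \<longlongrightarrow> G c) (at_left c)"
    using continuous_on_Icc_at_leftD[OF contG c] .
  ultimately have "(F \<longlongrightarrow> incomplete_period a b 0 + G c) (at_left c)"
    unfolding F_def by (rule tendsto_add)
  then have "G c = F (c / 2)"
    using tendsto_unique[OF _ _ tendsto_eventually[OF evc]] by (auto simp: trivial_limit_at_left_real)
  with e0 show "complete_period (l - r) (l - s) = G c - G 0"
    by (simp add: a_def b_def)
qed

section \<open>The hypergeometric function as an elliptic integral\<close>

definition third_coeff :: "nat \<Rightarrow> real" where
  "third_coeff n = pochhammer (1/3) n * pochhammer (2/3) n / (pochhammer (1/2) n * fact n)"

lemma third_coeff_0 [simp]: "third_coeff 0 = 1"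
  by (simp add: third_coeff_def)

lemma third_coeff_Suc:
  "third_coeff (Suc n) = third_coeff n * ((n + 1/3) * (n + 2/3) / ((n + 1/2) * (n + 1)))"
proof -
  have "pochhammer (1/2) n \<noteq> (0::real)"
    using pochhammer_pos[of "1/2::real" n] by simp
  moreover have "real n + 1/2 \<noteq> 0" by linarith
  ultimately show ?thesis
    by (simp add: third_coeff_def pochhammer_rec' divide_simps) (simp add: algebra_simps)
qed

text \<open>The ratio of consecutive coefficients is positive and at most 1, since (n + 1/3) (n +
  2/3) \<le> (n + 1/2) (n + 1). A geometric series therefore serves as majorant wherever these
  coefficients occur.\<close>

lemma third_coeff_bounds: "0 < third_coeff n \<and> third_coeff n \<le> 1"
proof (induction n)
  case (Suc n)
  have "(real n + 1/3) * (n + 2/3) \<le> (n + 1/2) * (n + 1)"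
    by (simp add: field_simps)
  then have "(real n + 1/3) * (n + 2/3) / ((n + 1/2) * (n + 1)) \<le> 1"
    by (subst divide_le_eq_1_pos) auto
  moreover have "0 < (real n + 1/3) * (n + 2/3) / ((n + 1/2) * (n + 1))"
    by simp
  ultimately show ?case
    using Suc mult_le_one[of "third_coeff n" "(real n + 1/3) * (n + 2/3) / ((n + 1/2) * (n + 1))"]
    unfolding third_coeff_Suc by (simp del: times_divide_eq_right add: add.commute)
qed simp

text \<open>The Taylor coefficients of 3 sin (arcsin x / 3).\<close>

definition third_sine_coeff :: "nat \<Rightarrow> real" where
  "third_sine_coeff n = (if odd n then third_coeff (n div 2) / n else 0)"

text \<open>This is (1 - x^2) u'' = x u' - u / 9, the differential equation of sin (arcsin x / 3),
  read off coefficient by coefficient.\<close>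

lemma third_sine_coeff_rec:
  "(real n + 2) * (real n + 1) * third_sine_coeff (n + 2) = ((real n)\<^sup>2 - 1/9) * third_sine_coeff n"
proof (cases "odd n")
  case True
  then obtain m where n: "n = 2 * m + 1" by (elim oddE)
  have ne: "real m + 1/2 \<noteq> 0" "real m * 2 + 1 \<noteq> 0" "real m * 2 + 3 \<noteq> 0" "real m + 1 \<noteq> 0"
    by (simp_all add: add_eq_0_iff)
  have "n div 2 = m" "(n + 2) div 2 = Suc m" by (auto simp: n)
  then have u: "third_sine_coeff n = third_coeff m / (2 * m + 1)"
    "third_sine_coeff (n + 2) = third_coeff (Suc m) / (2 * m + 3)"
    using True by (simp_all add: third_sine_coeff_def n add_ac)
  have rn: "real n = 2 * m + 1" by (simp add: n)
  show ?thesis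
    unfolding u third_coeff_Suc rn using ne by (simp add: divide_simps) (simp add: algebra_simps power2_eq_square)
qed (simp add: third_sine_coeff_def)

lemma third_sine_coeff_summable:
  fixes x :: real
  assumes "\<bar>x\<bar> < 1"
  shows "summable (\<lambda>n. third_sine_coeff n * x ^ n)"
proof (rule summable_comparison_test')
  show "summable (\<lambda>n. \<bar>x\<bar> ^ n)" using assms by (intro summable_geometric) auto
  fix n :: nat
  have "\<bar>third_sine_coeff n\<bar> \<le> 1"
  proof (cases "odd n")
    case True
    then have "real n \<ge> 1" by (cases n) auto
    then show ?thesis
      using third_coeff_bounds[of "n div 2"] True
      by (simp add: third_sine_coeff_def)
  qed (simp add: third_sine_coeff_def)
  then show "norm (third_sine_coeff n * x ^ n) \<le> \<bar>x\<bar> ^ n"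
    by (simp add: abs_mult power_abs mult_left_le_one_le)
qed

lemma diffs_summable_unit:
  fixes c :: "nat \<Rightarrow> real"
  assumes "\<And>x. \<bar>x\<bar> < 1 \<Longrightarrow> summable (\<lambda>n. c n * x ^ n)" "\<bar>x\<bar> < 1"
  shows "summable (\<lambda>n. diffs c n * x ^ n)"
  using assms by (intro termdiff_converges[of _ 1]) auto

lemma powser_deriv_unit:
  fixes c :: "nat \<Rightarrow> real"
  assumes "\<And>x. \<bar>x\<bar> < 1 \<Longrightarrow> summable (\<lambda>n. c n * x ^ n)" "\<bar>x\<bar> < 1"
  shows "((\<lambda>x. \<Sum>n. c n * x ^ n) has_real_derivative (\<Sum>n. diffs c n * x ^ n)) (at x)"
proof -
  obtain K where "\<bar>x\<bar> < K" "K < 1" using assms(2) dense by blast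
  then show ?thesis
    by (intro termdiffs_strong[of _ K] assms(1)) auto
qed

lemma third_sine_ode:
  fixes x :: real
  assumes x: "\<bar>x\<bar> < 1"
  defines "u \<equiv> third_sine_coeff"
  shows "(1 - x\<^sup>2) * (\<Sum>n. diffs (diffs u) n * x ^ n) =
           x * (\<Sum>n. diffs u n * x ^ n) - (\<Sum>n. u n * x ^ n) / 9"
proof -
  note s0 = third_sine_coeff_summable
  have s1: "\<bar>x\<bar> < 1 \<Longrightarrow> summable (\<lambda>n. diffs u n * x ^ n)" for x
    unfolding u_def by (rule diffs_summable_unit[OF s0])
  have s2: "\<bar>x\<bar> < 1 \<Longrightarrow> summable (\<lambda>n. diffs (diffs u) n * x ^ n)" for x
    by (rule diffs_summable_unit[OF s1])
  have "(\<lambda>n. real n * u n * x ^ (n - Suc 0) * x) sums ((\<Sum>n. diffs u n * x ^ n) * x)"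
    by (intro sums_mult2 diffs_equiv s1 x)
  moreover have "real n * u n * x ^ (n - Suc 0) * x = real n * u n * x ^ n" for n
    by (cases n) auto
  ultimately have S1: "(\<lambda>n. real n * u n * x ^ n) sums (x * (\<Sum>n. diffs u n * x ^ n))"
    by (simp only: mult.commute[of x])
  have "(\<lambda>n. real n * diffs u n * x ^ (n - Suc 0) * x\<^sup>2) sums ((\<Sum>n. diffs (diffs u) n * x ^ n) * x\<^sup>2)"
    by (intro sums_mult2 diffs_equiv s2 x)
  moreover have "real n * diffs u n * x ^ (n - Suc 0) * x\<^sup>2 = (real (Suc n) * (real (Suc n) - 1)) * u (Suc n) * x ^ Suc n" for n
    by (cases n) (auto simp: diffs_def power2_eq_square)
  ultimately have "(\<lambda>n. (real (Suc n) * (real (Suc n) - 1)) * u (Suc n) * x ^ Suc n) sums (x\<^sup>2 * (\<Sum>n. diffs (diffs u) n * x ^ n))"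
    by (simp only: mult.commute[of "x\<^sup>2"])
  then have S2: "(\<lambda>n. (real n * (real n - 1)) * u n * x ^ n) sums (x\<^sup>2 * (\<Sum>n. diffs (diffs u) n * x ^ n))"
    by (subst (asm) sums_Suc_iff) simp
  have S0: "(\<lambda>n. u n * x ^ n / 9) sums ((\<Sum>n. u n * x ^ n) / 9)"
    unfolding u_def by (intro sums_divide summable_sums s0 x)
  have S3: "(\<lambda>n. diffs (diffs u) n * x ^ n) sums (\<Sum>n. diffs (diffs u) n * x ^ n)"
    by (intro summable_sums s2 x)
  have "(\<lambda>n. real n * u n * x ^ n - u n * x ^ n / 9 + (real n * (real n - 1)) * u n * x ^ n) sums
     (x * (\<Sum>n. diffs u n * x ^ n) - (\<Sum>n. u n * x ^ n) / 9 + x\<^sup>2 * (\<Sum>n. diffs (diffs u) n * x ^ n))"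
    by (intro sums_add sums_diff S0 S1 S2)
  moreover have "real n * u n * x ^ n - u n * x ^ n / 9 + (real n * (real n - 1)) * u n * x ^ n
      = diffs (diffs u) n * x ^ n" for n
  proof -
    have "diffs (diffs u) n = ((real n)\<^sup>2 - 1/9) * u n"
      using third_sine_coeff_rec[of n] unfolding u_def by (simp add: diffs_def add_ac mult_ac)
    then show ?thesis by (simp only:) (simp add: algebra_simps power2_eq_square)
  qed
  ultimately have "(\<lambda>n. diffs (diffs u) n * x ^ n) sums
     (x * (\<Sum>n. diffs u n * x ^ n) - (\<Sum>n. u n * x ^ n) / 9 + x\<^sup>2 * (\<Sum>n. diffs (diffs u) n * x ^ n))"
    by simp
  from sums_unique2[OF this S3] show ?thesis by (simp add: algebra_simps)
qed

text \<open>The series is the derivative of the one with coefficients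
  \<open>third_sine_coeff\<close>. That primitive is easier to identify: in the variable s with x =
  sin s its equation becomes y'' = - y / 9, with constant coefficients.\<close>

lemma third_coeff_sums:
  assumes "\<bar>t\<bar> < pi / 2"
  shows "(\<lambda>n. third_coeff n * sin t ^ (2 * n)) sums (cos (t / 3) / cos t)"
proof -
  define u where "u = third_sine_coeff"
  define U where "U x = (\<Sum>n. u n * x ^ n)" for x
  define U1 where "U1 x = (\<Sum>n. diffs u n * x ^ n)" for x
  define U2 where "U2 x = (\<Sum>n. diffs (diffs u) n * x ^ n)" for x
  note s0 = third_sine_coeff_summable[folded u_def]
  note s1 = diffs_summable_unit[OF s0]
  have dU: "(U has_real_derivative U1 x) (at x)" if "\<bar>x\<bar> < 1" for x
    using powser_deriv_unit[OF s0 that] by (simp add: U_def[abs_def] U1_def)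
  have dU1: "(U1 has_real_derivative U2 x) (at x)" if "\<bar>x\<bar> < 1" for x
    using powser_deriv_unit[OF s1 that] by (simp add: U1_def[abs_def] U2_def)
  \<comment> \<open>For y(s) = U (sin s), \<open>C1\<close> and \<open>C2\<close> are the first
    integrals of y'' = - y / 9 obtained by pairing (y', y) with cos (s / 3) and sin (s / 3). Their
    values 1 and 0 at the origin give y' = cos (s / 3).\<close>
  define C1 where "C1 s = U1 (sin s) * cos s * cos (s / 3) + U (sin s) * sin (s / 3) / 3" for s
  define C2 where "C2 s = U1 (sin s) * cos s * sin (s / 3) - U (sin s) * cos (s / 3) / 3" for s
  have cospos: "0 < cos s" if "\<bar>s\<bar> < pi / 2" for s
    using that by (intro cos_gt_zero_pi) auto
  have sin_lt: "\<bar>sin s\<bar> < 1" if "\<bar>s\<bar> < pi / 2" for s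
  proof -
    have "(sin s)\<^sup>2 < 1" using cospos[OF that] by (simp add: sin_squared_eq)
    then show ?thesis by (simp add: abs_square_less_1)
  qed
  have key: "U2 (sin s) * (cos s)\<^sup>2 = sin s * U1 (sin s) - U (sin s) / 9" if "\<bar>s\<bar> < pi / 2" for s
    using third_sine_ode[OF sin_lt[OF that]]
    unfolding U_def U1_def U2_def u_def by (simp add: cos_squared_eq mult_ac)
  have d: "((\<lambda>s. U (sin s)) has_real_derivative U1 (sin s) * cos s) (at s)"
          "((\<lambda>s. U1 (sin s)) has_real_derivative U2 (sin s) * cos s) (at s)" if "\<bar>s\<bar> < pi / 2" for s
    by (rule DERIV_chain2[OF dU DERIV_sin] DERIV_chain2[OF dU1 DERIV_sin], rule sin_lt[OF that])+
  have C1': "(C1 has_real_derivative 0) (at s)" if s: "\<bar>s\<bar> < pi / 2" for s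
  proof -
    have "(C1 has_real_derivative
        (U2 (sin s) * (cos s)\<^sup>2 - sin s * U1 (sin s) + U (sin s) / 9) * cos (s / 3)) (at s)"
      unfolding C1_def
      by (auto intro!: derivative_eq_intros d[OF s] simp: field_simps power2_eq_square)
    then show ?thesis using key[OF s] by simp
  qed
  have C2': "(C2 has_real_derivative 0) (at s)" if s: "\<bar>s\<bar> < pi / 2" for s
  proof -
    have "(C2 has_real_derivative
        (U2 (sin s) * (cos s)\<^sup>2 - sin s * U1 (sin s) + U (sin s) / 9) * sin (s / 3)) (at s)"
      unfolding C2_def
      by (auto intro!: derivative_eq_intros d[OF s] simp: field_simps power2_eq_square)
    then show ?thesis using key[OF s] by simp
  qed
  have "C1 t = C1 0"
    by (rule DERIV_isconst3[where a = "- (pi / 2)" and b = "pi / 2"]) (use assms in \<open>auto intro!: C1'\<close>)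
  moreover have "C2 t = C2 0"
    by (rule DERIV_isconst3[where a = "- (pi / 2)" and b = "pi / 2"]) (use assms in \<open>auto intro!: C2'\<close>)
  moreover have "C1 0 = 1"
    by (simp add: C1_def U1_def u_def third_sine_coeff_def diffs_def)
  moreover have "C2 0 = 0"
    by (simp add: C2_def U_def u_def third_sine_coeff_def)
  ultimately have C: "C1 t = 1" "C2 t = 0" by auto
  have "U1 (sin t) * cos t = U1 (sin t) * cos t * ((cos (t / 3))\<^sup>2 + (sin (t / 3))\<^sup>2)"
    by simp
  also have "\<dots> = C1 t * cos (t / 3) + C2 t * sin (t / 3)"
    unfolding C1_def C2_def distrib_left distrib_right left_diff_distrib by (simp add: power2_eq_square)
  finally have U1t: "U1 (sin t) = cos (t / 3) / cos t"
    using C cospos[OF assms] by (simp add: field_simps)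
  \<comment> \<open>Only even powers survive differentiation of an odd series, and the factor 2 n +
    1 cancels the denominator in \<open>third_sine_coeff\<close>, leaving
    \<open>third_coeff n\<close>.\<close>
  have "(\<lambda>n. diffs u n * sin t ^ n) sums U1 (sin t)"
    unfolding U1_def by (intro summable_sums s1 sin_lt assms)
  moreover have "strict_mono (\<lambda>n::nat. 2 * n)" by (auto simp: strict_mono_def)
  moreover have "diffs u n * sin t ^ n = 0" if "n \<notin> range (\<lambda>n. 2 * n)" for n
  proof -
    have "odd n" using that by (auto elim: evenE)
    then show ?thesis by (simp add: diffs_def u_def third_sine_coeff_def)
  qed
  ultimately have "(\<lambda>n. diffs u (2 * n) * sin t ^ (2 * n)) sums U1 (sin t)"
    using sums_mono_reindex[of "\<lambda>n::nat. 2 * n" "\<lambda>n. diffs u n * sin t ^ n"] by simp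
  moreover have "diffs u (2 * n) = third_coeff n" for n
    by (simp add: diffs_def u_def third_sine_coeff_def del: of_nat_Suc)
  ultimately show ?thesis by (simp add: U1t)
qed

text \<open>The function sin^(2n+1) cos vanishes at 0 and pi / 2; integrating its derivative gives
  the recursion with ratio (2 n + 1) / (2 n + 2), which is the ratio of consecutive values of
  (1/2)_n / n!.\<close>

lemma wallis_even_integral:
  "((\<lambda>x. sin x ^ (2 * n)) has_integral (pi / 2 * pochhammer (1/2) n / fact n)) {0..pi/2}"
proof (induction n)
  case 0
  show ?case using has_integral_const_real[of "1::real" 0 "pi/2"] by simp
next
  case (Suc n)
  have "((\<lambda>x. (2 * n + 1) * sin x ^ (2 * n) - (2 * n + 2) * sin x ^ (2 * n + 2)) has_integral
          (sin (pi / 2) ^ (2 * n + 1) * cos (pi / 2) - sin 0 ^ (2 * n + 1) * cos 0)) {0..pi/2}"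
  proof (rule fundamental_theorem_of_calculus)
    fix x :: real
    have "((\<lambda>x. sin x ^ (2 * n + 1) * cos x) has_real_derivative
        (2 * n + 1) * sin x ^ (2 * n) * (cos x)\<^sup>2 - sin x ^ (2 * n + 2)) (at x within {0..pi/2})"
      by (rule derivative_eq_intros refl)+ (simp add: algebra_simps power2_eq_square)
    also have "(2 * n + 1) * sin x ^ (2 * n) * (cos x)\<^sup>2 - sin x ^ (2 * n + 2)
       = (2 * n + 1) * sin x ^ (2 * n) - (2 * n + 2) * sin x ^ (2 * n + 2)"
      unfolding cos_squared_eq by (simp add: algebra_simps power2_eq_square)
    finally show "((\<lambda>x. sin x ^ (2 * n + 1) * cos x) has_vector_derivative
        (2 * n + 1) * sin x ^ (2 * n) - (2 * n + 2) * sin x ^ (2 * n + 2)) (at x within {0..pi/2})"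
      by (simp add: has_real_derivative_iff_has_vector_derivative)
  qed auto
  then have "((\<lambda>x. (2 * n + 1) * sin x ^ (2 * n) - (2 * n + 2) * sin x ^ (2 * n + 2)) has_integral 0) {0..pi/2}"
    by simp
  from has_integral_diff[OF has_integral_mult_right[OF Suc.IH, of "real (2 * n + 1)"] this]
  have "((\<lambda>x. (2 * n + 2) * sin x ^ (2 * n + 2)) has_integral
      (2 * n + 1) * (pi / 2 * pochhammer (1/2) n / fact n)) {0..pi/2}"
    by simp
  from has_integral_mult_right[OF this, of "1 / real (2 * n + 2)"]
  have "((\<lambda>x. sin x ^ (2 * n + 2)) has_integral
      (2 * n + 1) / (2 * n + 2) * (pi / 2 * pochhammer (1/2) n / fact n)) {0..pi/2}"
    by (simp add: mult.assoc[symmetric] del: of_nat_Suc of_nat_add of_nat_mult)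
  also have "(2 * n + 1) / (2 * n + 2) * (pi / 2 * pochhammer (1/2) n / fact n)
     = pi / 2 * pochhammer (1/2) (Suc n) / fact (Suc n)"
    by (simp add: pochhammer_rec' divide_simps)
  finally show ?case by simp
qed

text \<open>Since k < 1, the geometric series in k^2 dominates the expansion uniformly in p, so
  integral and sum may be interchanged. The Wallis factor cancels the symbol (1/2)_n in
  \<open>third_coeff\<close> and leaves n! = (1)_n in its place.\<close>

lemma has_integral_hyp2F1_third:
  fixes k :: real
  assumes "0 < k" "k < 1"
  shows "((\<lambda>p. cos (arcsin (k * sin p) / 3) / cos (arcsin (k * sin p))) has_integral
           (pi / 2 * hyp2F1 (1/3) (2/3) 1 (k\<^sup>2))) {0..pi/2}"
proof -
  define F where "F p = cos (arcsin (k * sin p) / 3) / cos (arcsin (k * sin p))" for p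
  have lt: "\<bar>k * sin p\<bar> < 1" for p
    using assms order.strict_trans1[OF mult_left_mono[OF abs_sin_le_one[of p], of k], of 1] by (simp add: abs_mult)
  have sums: "(\<lambda>n. third_coeff n * (k * sin p) ^ (2 * n)) sums F p" for p
  proof -
    have "\<bar>arcsin (k * sin p)\<bar> < pi / 2"
      unfolding abs_less_iff using lt[of p] arcsin_lt_bounded[of "k * sin p"] by (auto simp: abs_less_iff)
    from third_coeff_sums[OF this] show ?thesis
      using lt[of p] by (simp add: F_def abs_less_iff)
  qed
  have unif: "uniform_limit {0..pi/2} (\<lambda>n p. \<Sum>i<n. third_coeff i * (k * sin p) ^ (2 * i))
        (\<lambda>p. \<Sum>i. third_coeff i * (k * sin p) ^ (2 * i)) sequentially"
  proof (rule Weierstrass_m_test)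
    show "summable (\<lambda>n. (k\<^sup>2) ^ n)"
      using assms by (intro summable_geometric) (simp add: power_less_one_iff abs_square_less_1)
    fix n p
    have "\<bar>k * sin p\<bar> ^ (2 * n) \<le> k ^ (2 * n)"
      using assms mult_left_mono[of "\<bar>sin p\<bar>" 1 k] by (intro power_mono) (auto simp: abs_mult)
    then have "\<bar>third_coeff n\<bar> * \<bar>k * sin p\<bar> ^ (2 * n) \<le> 1 * k ^ (2 * n)"
      using third_coeff_bounds[of n] by (intro mult_mono) auto
    then show "norm (third_coeff n * (k * sin p) ^ (2 * n)) \<le> (k\<^sup>2) ^ n"
      by (simp add: abs_mult power_abs power_mult)
  qed
  have eqF: "(\<lambda>p. \<Sum>i. third_coeff i * (k * sin p) ^ (2 * i)) = F"
    using sums by (auto simp: sums_iff)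
  obtain I J where I: "\<And>n. ((\<lambda>p. \<Sum>i<n. third_coeff i * (k * sin p) ^ (2 * i)) has_integral I n) {0..pi/2}"
    and J: "(F has_integral J) {0..pi/2}" and lim: "I \<longlonglongrightarrow> J"
    by (rule uniform_limit_integral[OF unif[unfolded eqF]]) (auto intro!: continuous_intros)
  have "I n = (\<Sum>i<n. pi / 2 * (pochhammer (1/3) i * pochhammer (2/3) i / (pochhammer 1 i * fact i) * (k\<^sup>2) ^ i))" for n
  proof (rule has_integral_unique[OF I])
    have "((\<lambda>p. \<Sum>i<n. third_coeff i * k ^ (2 * i) * sin p ^ (2 * i)) has_integral
       (\<Sum>i<n. third_coeff i * k ^ (2 * i) * (pi / 2 * pochhammer (1/2) i / fact i))) {0..pi/2}"
      by (intro has_integral_sum has_integral_mult_right wallis_even_integral) auto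
    moreover have "third_coeff i * k ^ (2 * i) * (pi / 2 * pochhammer (1/2) i / fact i)
       = pi / 2 * (pochhammer (1/3) i * pochhammer (2/3) i / (pochhammer 1 i * fact i) * (k\<^sup>2) ^ i)" for i
    proof -
      have "pochhammer (1/2) i \<noteq> (0::real)"
        using pochhammer_pos[of "1/2::real" i] by simp
      then show ?thesis
        by (simp add: third_coeff_def pochhammer_fact[symmetric] power_mult[symmetric] field_simps)
    qed
    ultimately show "((\<lambda>p. \<Sum>i<n. third_coeff i * (k * sin p) ^ (2 * i)) has_integral
       (\<Sum>i<n. pi / 2 * (pochhammer (1/3) i * pochhammer (2/3) i / (pochhammer 1 i * fact i) * (k\<^sup>2) ^ i))) {0..pi/2}"
      by (simp add: power_mult_distrib mult.assoc)
  qed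
  then have "I = (\<lambda>n. \<Sum>i<n. pi / 2 * (pochhammer (1/3) i * pochhammer (2/3) i / (pochhammer 1 i * fact i) * (k\<^sup>2) ^ i))"
    by (rule ext)
  with lim have "(\<lambda>i. pi / 2 * (pochhammer (1/3) i * pochhammer (2/3) i / (pochhammer 1 i * fact i) * (k\<^sup>2) ^ i)) sums J"
    by (simp only: sums_def)
  from sums_divide[OF this, of "pi / 2"]
  have "(\<lambda>i. pochhammer (1/3) i * pochhammer (2/3) i / (pochhammer 1 i * fact i) * (k\<^sup>2) ^ i) sums (J / (pi / 2))"
    by simp
  then have "J = pi / 2 * hyp2F1 (1/3) (2/3) 1 (k\<^sup>2)"
    unfolding hyp2F1_def by (simp add: sums_iff)
  with J show ?thesis by (simp add: F_def[abs_def])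
qed

text \<open>The rational function R is the first coordinate of a 3-isogeny from the curve
  y^2 = v (k - v (3 - 4 v)^2) onto the curve with invariants G2 and G3. Its kernel consists of the
  point over v = 0 and the two points over v = \<infinity>.\<close>

lemma signature_three_identity:
  fixes v k :: real
  assumes "v \<noteq> 0"
  defines "R \<equiv> 2 * k / (3 * v) - 2 + 32 * v - 128 / 3 * v\<^sup>2"
  shows "(- 2 * k / (3 * v\<^sup>2) + 32 - 256 / 3 * v)\<^sup>2 * (4 / 9 * v * (k - v * (3 - 4 * v)\<^sup>2))
     = (4 * R ^ 3 - 48 * (1 + 8 * k) * R - 64 * (1 - 20 * k - 8 * k\<^sup>2)) / 6"
proof -
  \<comment> \<open>With w for 1 / v, both sides are polynomials in v, w and k, and the identity
    holds modulo v w = 1.\<close>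
  define w where "w = 1 / v"
  have vw: "v * w = 1" using assms by (simp add: w_def)
  have R: "R = 2 / 3 * k * w - 2 + 32 * v - 128 / 3 * v\<^sup>2"
    "- 2 * k / (3 * v\<^sup>2) = - 2 / 3 * k * w\<^sup>2"
    by (simp_all add: R_def w_def power_divide)
  show ?thesis unfolding R using vw by algebra
qed

lemma sin_treble: "sin (3 * x) = sin x * (3 - 4 * (sin x)\<^sup>2)" for x :: real
proof -
  have c: "(cos x)\<^sup>2 = 1 - (sin x)\<^sup>2" by (rule cos_squared_eq)
  have "sin (3 * x) = sin (2 * x + x)" by simp
  also have "\<dots> = sin x * (3 - 4 * (sin x)\<^sup>2)"
    unfolding sin_add sin_double cos_double using c by algebra
  finally show ?thesis .
qed

text \<open>The criterion \<open>complete_period_eqI\<close> is applied on (0, pi / 2) to p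
  \<mapsto> \<open>R (v p)\<close>, with G the integral of \<open>f\<close> / sqrt 6. By
  \<open>kcos\<close> the radicand of the isogenous curve is the square of \<kappa> cos p, so
  \<open>signature_three_identity\<close> supplies the differential equation.\<close>

lemma complete_period_signature_three:
  fixes \<kappa> :: real
  assumes k: "0 < \<kappa>" "\<kappa> < 1" and e: "e3 < e2" "e2 < e1"
    and cubic: "\<And>x. 4 * x ^ 3 - 48 * (1 + 8 * \<kappa>\<^sup>2) * x - 64 * (1 - 20 * \<kappa>\<^sup>2 - 8 * \<kappa> ^ 4)
                   = 4 * (x - e1) * (x - e2) * (x - e3)"
  shows "complete_period (e1 - e2) (e1 - e3) = 1 / (2 * sqrt 6) * pi * hyp2F1 (1/3) (2/3) 1 (\<kappa>\<^sup>2)"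
proof -
  define th where "th p = arcsin (\<kappa> * sin p)" for p
  define f where "f p = cos (th p / 3) / cos (th p)" for p
  define v where "v p = (sin (th p / 3))\<^sup>2" for p
  define R where "R x = 2 * \<kappa>\<^sup>2 / (3 * x) - 2 + 32 * x - 128 / 3 * x\<^sup>2" for x
  define R' where "R' x = - 2 * \<kappa>\<^sup>2 / (3 * x\<^sup>2) + 32 - 256 / 3 * x" for x
  define D where "D p = R' (v p) * (2 / 3 * sin (th p / 3) * (\<kappa> * cos p) * f p)" for p
  define G where "G p = integral {0..p} (\<lambda>p. f p / sqrt 6)" for p
  have lt: "\<bar>\<kappa> * sin p\<bar> < 1" for p
    using k order.strict_trans1[OF mult_left_mono[OF abs_sin_le_one[of p], of \<kappa>], of 1]
    by (simp add: abs_mult)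
  have th_bound: "\<bar>th p\<bar> < pi / 2" for p
    unfolding abs_less_iff th_def using lt[of p] arcsin_lt_bounded[of "\<kappa> * sin p"] by (auto simp: abs_less_iff)
  have sin_th: "sin (th p) = \<kappa> * sin p" for p
    using lt[of p] by (simp add: th_def abs_less_iff)
  have cos_th: "0 < cos (th p)" "0 < cos (th p / 3)" for p
    using th_bound[of p] by (auto intro!: cos_gt_zero_pi simp: abs_less_iff)
  have sqrt_cos: "sqrt (1 - (\<kappa> * sin p)\<^sup>2) = cos (th p)" for p
    using lt[of p] by (simp add: th_def cos_arcsin abs_less_iff)
  have f_pos: "0 < f p" for p using cos_th by (simp add: f_def)
  have th_pos: "0 < th p" if "0 < p" "p \<le> pi / 2" for p
  proof -
    have "0 < \<kappa> * sin p" using k that pi_gt_zero by (intro mult_pos_pos sin_gt_zero) linarith+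
    then show ?thesis using lt[of p] arcsin_less_mono[of 0 "\<kappa> * sin p"] by (simp add: th_def)
  qed
  have sin3_pos: "0 < sin (th p / 3)" if "0 < p" "p \<le> pi / 2" for p
    using th_pos[OF that] th_bound[of p] by (intro sin_gt_zero) auto
  have v_pos: "0 < v p" if "0 < p" "p \<le> pi / 2" for p
    using sin3_pos[OF that] by (simp add: v_def)
  have trip: "(\<kappa> * sin p)\<^sup>2 = v p * (3 - 4 * v p)\<^sup>2" for p
    using sin_treble[of "th p / 3"] by (simp add: sin_th v_def power_mult_distrib)
  have kcos: "(\<kappa> * cos p)\<^sup>2 = \<kappa>\<^sup>2 - v p * (3 - 4 * v p)\<^sup>2" for p
    unfolding trip[symmetric] by (simp add: power_mult_distrib cos_squared_eq algebra_simps)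
  have dth: "(th has_real_derivative \<kappa> * cos p / cos (th p)) (at p)" for p
    unfolding th_def[abs_def] using lt[of p]
    by (auto intro!: derivative_eq_intros simp: sqrt_cos[unfolded th_def] abs_less_iff divide_inverse)
  have cont_th: "continuous_on S th" for S
    using dth by (intro DERIV_continuous_on[of _ _ "\<lambda>p. \<kappa> * cos p / cos (th p)"]) (auto intro: has_field_derivative_at_within)
  have cont_f: "continuous_on S f" for S
    unfolding f_def using cos_th(1) by (intro continuous_intros cont_th) (simp_all add: less_imp_neq[THEN not_sym])
  have dv: "(v has_real_derivative 2 / 3 * sin (th p / 3) * (\<kappa> * cos p) * f p) (at p)" for p
    unfolding v_def[abs_def] f_def
    by (auto intro!: derivative_eq_intros dth simp: field_simps)
  have dR: "(R has_real_derivative R' x) (at x)" if "x \<noteq> 0" for x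
    unfolding R_def[abs_def] R'_def using that
    by (auto intro!: derivative_eq_intros simp: field_simps power2_eq_square)
  have identity: "(R' x)\<^sup>2 * (4 / 9 * x * (\<kappa>\<^sup>2 - x * (3 - 4 * x)\<^sup>2))
      = 1 / 6 * (4 * (R x - e1) * (R x - e2) * (R x - e3))" if "x \<noteq> 0" for x
    using signature_three_identity[OF that, of "\<kappa>\<^sup>2"] cubic[of "R x"]
    by (simp add: R_def R'_def power_mult[symmetric])
  have X: "((\<lambda>p. R (v p)) has_real_derivative D p) (at p)" if "0 < p" "p < pi / 2" for p
    unfolding D_def by (rule DERIV_chain2[OF dR dv]) (use v_pos[of p] that in simp)
  have D_neg: "D p < 0" if p: "0 < p" "p < pi / 2" for p
  proof -
    have vp: "0 < v p" using v_pos p by simp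
    have cosp: "0 < \<kappa> * cos p" using k p by (intro mult_pos_pos cos_gt_zero) auto
    then have "v p * (3 - 4 * v p)\<^sup>2 < \<kappa>\<^sup>2" using kcos[of p] zero_less_power[OF cosp, of 2] by linarith
    \<comment> \<open>Replacing \<kappa>^2 by the smaller v (3 - 4 v)^2 only increases v^2 R'(v),
      and the result is - 6 v (1 - 4 v)^2. Thus R' < 0 although the square may vanish, because the
      replacement is strict.\<close>
    then have "- 2 / 3 * \<kappa>\<^sup>2 + 32 * (v p)\<^sup>2 - 256 / 3 * v p ^ 3
       < - 2 / 3 * (v p * (3 - 4 * v p)\<^sup>2) + 32 * (v p)\<^sup>2 - 256 / 3 * v p ^ 3" by linarith
    also have "\<dots> = - 6 * v p * (1 - 4 * v p)\<^sup>2"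
      by algebra
    also have "\<dots> \<le> 0" using vp by (simp add: mult_nonneg_nonneg)
    also have "- 2 / 3 * \<kappa>\<^sup>2 + 32 * (v p)\<^sup>2 - 256 / 3 * v p ^ 3 = R' (v p) * (v p)\<^sup>2"
      using vp by (simp add: R'_def ring_distribs power2_eq_square power3_eq_cube)
    finally have "R' (v p) * (v p)\<^sup>2 < 0" .
    then have "R' (v p) < 0" using vp by (simp add: mult_less_0_iff)
    moreover have "0 < 2 / 3 * sin (th p / 3) * (\<kappa> * cos p) * f p"
      by (intro mult_pos_pos sin3_pos f_pos cosp) (use p in auto)
    ultimately show ?thesis unfolding D_def by (rule mult_neg_pos)
  qed
  have ode: "(D p)\<^sup>2 = (f p / sqrt 6)\<^sup>2 * (4 * (R (v p) - e1) * (R (v p) - e2) * (R (v p) - e3))"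
    if p: "0 < p" "p < pi / 2" for p
  proof -
    have "(D p)\<^sup>2 = (R' (v p))\<^sup>2 * (4 / 9 * v p * (\<kappa> * cos p)\<^sup>2) * (f p)\<^sup>2"
      by (simp add: D_def v_def power_mult_distrib power_divide)
    also have "\<dots> = (f p / sqrt 6)\<^sup>2 * (4 * (R (v p) - e1) * (R (v p) - e2) * (R (v p) - e3))"
      unfolding kcos using identity[of "v p"] v_pos[of p] p by (simp add: power_divide)
    finally show ?thesis .
  qed
  have G: "(G has_real_derivative f p / sqrt 6) (at p)" if p: "0 < p" "p < pi / 2" for p
  proof -
    have "(G has_real_derivative f p / sqrt 6) (at p within {0..pi/2})"
      unfolding G_def[abs_def] using p
      by (intro integral_has_real_derivative continuous_intros cont_f) auto
    moreover have "at p within {0..pi/2} = at p"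
      using p by (intro at_within_interior) auto
    ultimately show ?thesis by simp
  qed
  have contG: "continuous_on {0..pi/2} G"
    unfolding G_def
    by (intro indefinite_integral_continuous_1 integrable_continuous_real continuous_intros cont_f) auto
  define l where "l = R (v (pi / 2))"
  have limc: "((\<lambda>p. R (v p)) \<longlongrightarrow> l) (at_left (pi / 2))"
  proof -
    have "isCont (\<lambda>p. R (v p)) (pi / 2)"
      by (rule isCont_o2[OF DERIV_isCont[OF dv] DERIV_isCont[OF dR]]) (use v_pos[of "pi / 2"] in simp)
    then show ?thesis
      unfolding l_def isCont_def by (rule tendsto_within_subset) auto
  qed
  have lim0: "filterlim (\<lambda>p. R (v p)) at_top (at_right 0)"
  proof -
    have v0: "(v \<longlongrightarrow> 0) (at_right 0)"
      using tendsto_within_subset[OF DERIV_isCont[OF dv, of 0, unfolded isCont_def], of "{0<..}"]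
      by (simp add: v_def th_def)
    have "\<forall>\<^sub>F p in at_right 0. 0 < v p"
      using eventually_at_right_real[of 0 "pi / 2"] by (auto elim!: eventually_mono intro!: v_pos)
    then have "filterlim v (at_right 0) (at_right 0)"
      unfolding filterlim_at using v0 by (auto elim: eventually_mono)
    then have "filterlim (\<lambda>p. inverse (v p)) at_top (at_right 0)"
      by (rule filterlim_compose[OF filterlim_inverse_at_top_right])
    then have "filterlim (\<lambda>p. (2 / 3 * \<kappa>\<^sup>2) * inverse (v p)) at_top (at_right 0)"
      using k by (intro filterlim_tendsto_pos_mult_at_top[OF tendsto_const]) auto
    moreover have "((\<lambda>p. - 2 + 32 * v p - 128 / 3 * (v p)\<^sup>2) \<longlongrightarrow> - 2 + 32 * 0 - 128 / 3 * 0\<^sup>2) (at_right 0)"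
      by (intro tendsto_intros v0)
    ultimately have "filterlim (\<lambda>p. (- 2 + 32 * v p - 128 / 3 * (v p)\<^sup>2) + (2 / 3 * \<kappa>\<^sup>2) * inverse (v p)) at_top (at_right 0)"
      by (intro filterlim_tendsto_add_at_top)
    \<comment> \<open>When \<open>v p\<close> = 0, both sides equal -2 because division by 0 gives
      0; so the equation holds for all p.\<close>
    moreover have "R (v p) = (- 2 + 32 * v p - 128 / 3 * (v p)\<^sup>2) + (2 / 3 * \<kappa>\<^sup>2) * inverse (v p)" for p
      unfolding R_def by (cases "v p = 0") (simp_all add: field_simps)
    ultimately show ?thesis by presburger
  qed
  \<comment> \<open>At p = pi / 2 the factor \<kappa> cos p vanishes, and with it the left side of
    the identity; hence the final value l is a root of the cubic.\<close>
  have "(l - e1) * (l - e2) * (l - e3) = 0"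
  proof -
    have "v (pi / 2) \<noteq> 0" using v_pos[of "pi / 2"] by simp
    from identity[OF this] kcos[of "pi / 2"] show ?thesis by (simp add: l_def)
  qed
  then consider "l = e1" | "l = e2" | "l = e3" by auto
  \<comment> \<open>Which root it is follows from the criterion itself: ending at e2 or e3 would
    make that root exceed e1.\<close>
  then have l: "l = e1"
  proof cases
    case 2
    have ode': "(D p)\<^sup>2 = (f p / sqrt 6)\<^sup>2 * (4 * (R (v p) - l) * (R (v p) - e1) * (R (v p) - e3))"
      if "0 < p" "p < pi / 2" for p
      unfolding ode[OF that] 2 by (simp only: ac_simps)
    have "e1 < l"
      by (rule complete_period_eqI(1)[OF _ X D_neg ode' _ G contG lim0 limc]) (use 2 e f_pos in auto)
    then show ?thesis using 2 e by simp
  next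
    case 3
    have ode': "(D p)\<^sup>2 = (f p / sqrt 6)\<^sup>2 * (4 * (R (v p) - l) * (R (v p) - e1) * (R (v p) - e2))"
      if "0 < p" "p < pi / 2" for p
      unfolding ode[OF that] 3 by (simp only: ac_simps)
    have "e1 < l"
      by (rule complete_period_eqI(1)[OF _ X D_neg ode' _ G contG lim0 limc]) (use 3 e f_pos in auto)
    then show ?thesis using 3 e by simp
  qed
  have "complete_period (l - e2) (l - e3) = G (pi / 2) - G 0"
    by (rule complete_period_eqI(3)[OF _ X D_neg ode[folded l] _ G contG lim0 limc])
       (use l e f_pos in auto)
  moreover have "((\<lambda>p. f p / sqrt 6) has_integral (pi / 2 * hyp2F1 (1/3) (2/3) 1 (\<kappa>\<^sup>2) / sqrt 6)) {0..pi/2}"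
    using has_integral_hyp2F1_third[OF k] unfolding f_def th_def by (rule has_integral_divide)
  then have "G (pi / 2) = pi / 2 * hyp2F1 (1/3) (2/3) 1 (\<kappa>\<^sup>2) / sqrt 6"
    unfolding G_def by (rule integral_unique)
  moreover have "G 0 = 0" by (simp add: G_def)
  ultimately show ?thesis by (simp add: l mult_ac)
qed

section \<open>The Weierstrass function of a rectangular lattice\<close>

lemma summable_on_int_powr:
  assumes "s < -1"
  shows "(\<lambda>m::int. (1 + \<bar>real_of_int m\<bar>) powr s) summable_on UNIV"
proof -
  have "summable (\<lambda>n. of_nat (Suc n) powr s :: real)"
    using summable_real_powr_iff[of s] assms by (subst summable_Suc_iff) simp
  then have nat: "(\<lambda>n::nat. (1 + real n) powr s) summable_on UNIV"
    by (subst summable_on_UNIV_nonneg_real_iff) simp_all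
  have "(\<lambda>m::int. (1 + \<bar>real_of_int m\<bar>) powr s) summable_on range int"
    by (subst summable_on_reindex) (use nat in \<open>auto simp: o_def\<close>)
  moreover have "(\<lambda>m::int. (1 + \<bar>real_of_int m\<bar>) powr s) summable_on range (\<lambda>n. - int n)"
    by (subst summable_on_reindex) (use nat in \<open>auto simp: o_def inj_on_def\<close>)
  ultimately have "(\<lambda>m::int. (1 + \<bar>real_of_int m\<bar>) powr s) summable_on (range int \<union> range (\<lambda>n. - int n))"
    by (rule summable_on_union)
  moreover have "m \<in> range int \<union> range (\<lambda>n. - int n)" for m
    by (cases m rule: int_cases2) auto
  then have "range int \<union> range (\<lambda>n. - int n) = UNIV" by blast
  ultimately show ?thesis by simp
qed

lemma summable_on_Times_nonneg:
  fixes f g :: "'a \<Rightarrow> real"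
  assumes "f summable_on A" "g summable_on B" "\<And>x. 0 \<le> f x" "\<And>y. 0 \<le> g y"
  shows "(\<lambda>(x, y). f x * g y) summable_on A \<times> B"
proof (rule summable_on_SigmaI)
  show "((\<lambda>y. case (x, y) of (x, y) \<Rightarrow> f x * g y) has_sum f x * infsum g B) B" for x
    using assms(2) by (auto intro!: has_sum_cmult_right has_sum_infsum)
  show "(\<lambda>x. f x * infsum g B) summable_on A"
    by (intro summable_on_cmult_left assms)
qed (use assms in auto)

lemma has_field_derivative_inverse_power:
  fixes u w :: "'a :: real_normed_field"
  assumes "0 < k" "u \<noteq> w"
  shows "((\<lambda>u. 1 / (u - w) ^ k) has_field_derivative - of_nat k * (1 / (u - w) ^ Suc k)) (at u)"
proof -
  have pow: "(u - w) ^ (k - Suc 0) * (u - w) = (u - w) ^ k"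
    using assms(1) by (cases k) auto
  have "((\<lambda>u. 1 / (u - w) ^ k) has_field_derivative
      - (of_nat k * (u - w) ^ (k - Suc 0)) / ((u - w) ^ k * (u - w) ^ k)) (at u)"
    using assms by (auto intro!: derivative_eq_intros)
  also have "- (of_nat k * (u - w) ^ (k - Suc 0)) / ((u - w) ^ k * (u - w) ^ k) = - of_nat k * (1 / (u - w) ^ Suc k)"
    using assms pow by (simp add: divide_simps mult_ac)
  finally show ?thesis .
qed

locale rect_lattice =
  fixes A B :: real
  assumes A_pos: "0 < A" and B_pos: "0 < B"
begin

definition L :: "complex set" where
  "L = lattice (2 * complex_of_real A) (2 * (\<i> * complex_of_real B))"

lemma L_eq: "L = (\<lambda>(m, n). Complex (2 * A * real_of_int m) (2 * B * real_of_int n)) ` UNIV"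
proof -
  have "of_int m * (2 * complex_of_real A) + of_int n * (2 * (\<i> * complex_of_real B))
      = Complex (2 * A * real_of_int m) (2 * B * real_of_int n)" for m n
    by (simp add: complex_eq_iff)
  then show ?thesis by (auto simp: L_def lattice_def)
qed

lemma Complex_in_L_iff: "Complex x y \<in> L \<longleftrightarrow> (\<exists>(m::int) (n::int). x = 2 * A * m \<and> y = 2 * B * n)"
  by (auto simp: L_eq complex_eq_iff)

lemma L_iff: "z \<in> L \<longleftrightarrow> (\<exists>(m::int) (n::int). Re z = 2 * A * m \<and> Im z = 2 * B * n)"
  using Complex_in_L_iff[of "Re z" "Im z"] by simp

lemma L_0 [simp]: "0 \<in> L"
  by (auto simp: L_iff intro!: exI[of _ 0])

lemma L_add: "z \<in> L \<Longrightarrow> w \<in> L \<Longrightarrow> z + w \<in> L"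
  unfolding L_iff by (metis distrib_left of_int_add plus_complex.simps)

lemma L_minus_iff [simp]: "- z \<in> L \<longleftrightarrow> z \<in> L"
proof -
  have "- z \<in> L" if "z \<in> L" for z
    using that unfolding L_iff by (metis mult_minus_right of_int_minus uminus_complex.simps)
  from this[of z] this[of "- z"] show ?thesis by auto
qed

lemma L_diff: "z \<in> L \<Longrightarrow> w \<in> L \<Longrightarrow> z - w \<in> L"
  using L_add[of z "- w"] by simp

lemma L_add_iff: "w \<in> L \<Longrightarrow> z + w \<in> L \<longleftrightarrow> z \<in> L"
  using L_add[of z w] L_diff[of "z + w" w] by auto

lemma L_diff_iff: "w \<in> L \<Longrightarrow> z - w \<in> L \<longleftrightarrow> z \<in> L"
  using L_add_iff[of "- w" z] by simp

lemma L_cnj_iff [simp]: "cnj z \<in> L \<longleftrightarrow> z \<in> L"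
proof -
  have "cnj z \<in> L" if "z \<in> L" for z
    using that unfolding L_iff by (metis mult_minus_right of_int_minus cnj.simps)
  from this[of z] this[of "cnj z"] show ?thesis by auto
qed

lemma countable_L: "countable L"
  by (simp add: L_eq)

definition gap :: real where "gap = 2 * min A B"

lemma gap_pos: "0 < gap"
  using A_pos B_pos by (simp add: gap_def)

lemma L_norm_ge:
  assumes "w \<in> L" "w \<noteq> 0"
  shows "gap \<le> norm w"
proof -
  obtain m n :: int where mn: "Re w = 2 * A * m" "Im w = 2 * B * n"
    using assms(1) by (auto simp: L_iff)
  show ?thesis
  proof (cases "m = 0")
    case True
    then have "n \<noteq> 0" using mn assms(2) by (auto simp: complex_eq_iff)
    then have "1 \<le> \<bar>real_of_int n\<bar>" by linarith
    then have "2 * B * 1 \<le> 2 * B * \<bar>real_of_int n\<bar>"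
      using B_pos by (intro mult_left_mono) auto
    also have "\<dots> = \<bar>Im w\<bar>" using mn B_pos by (simp add: abs_mult)
    also have "\<dots> \<le> norm w" by (rule abs_Im_le_cmod)
    finally show ?thesis by (simp add: gap_def min_def split: if_splits)
  next
    case False
    then have "1 \<le> \<bar>real_of_int m\<bar>" by linarith
    then have "2 * A * 1 \<le> 2 * A * \<bar>real_of_int m\<bar>"
      using A_pos by (intro mult_left_mono) auto
    also have "\<dots> = \<bar>Re w\<bar>" using mn A_pos by (simp add: abs_mult)
    also have "\<dots> \<le> norm w" by (rule abs_Re_le_cmod)
    finally show ?thesis by (simp add: gap_def min_def split: if_splits)
  qed
qed

lemma closed_subset_L:
  assumes "S \<subseteq> L"
  shows "closed S"
proof (rule discrete_imp_closed[OF gap_pos], intro ballI impI)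
  fix x y assume "x \<in> S" "y \<in> S" "dist y x < gap"
  then show "y = x"
    using L_norm_ge[of "y - x"] L_diff[of y x] assms by (auto simp: dist_norm)
qed

lemma open_compl_L: "open (- L)" and open_compl_L0: "open (- (L - {0}))"
  by (intro open_Compl closed_subset_L; simp)+

lemma connected_compl_L: "connected (- L)"
  by (intro path_connected_imp_connected path_connected_complement_countable countable_L) auto

text \<open>For w = 2Am + 2iBn one has (1 + |m|) (1 + |n|) \<le> 3 (m^2 + n^2) \<le> 3 |w|^2 /
  gap^2. Raised to the power 3/2, this bounds |w|^(-3) by a multiple of a product of two
  one-dimensional terms with exponent -3/2, each summable.\<close>

lemma summable_norm_L3: "(\<lambda>w. 1 / norm w ^ 3) summable_on (L - {0})"
proof -
  define h where "h = (\<lambda>(m::int, n::int). Complex (2 * A * m) (2 * B * n))"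
  have inj: "inj h" using A_pos B_pos by (auto simp: h_def inj_on_def)
  have h0: "h x = 0 \<longleftrightarrow> x = (0, 0)" for x
    using A_pos B_pos by (cases x) (simp add: h_def Complex_eq_0)
  have "L = range h" by (simp add: L_eq h_def)
  then have img: "L - {0} = h ` (UNIV - {(0, 0)})"
    using image_set_diff[OF inj, of UNIV "{(0, 0)}"] h0[of "(0, 0)"] by simp
  define q where "q m = (1 + \<bar>real_of_int m\<bar>) powr (- (3 / 2))" for m
  have "(\<lambda>(m, n). q m * q n) summable_on UNIV \<times> UNIV"
    unfolding q_def by (intro summable_on_Times_nonneg summable_on_int_powr) auto
  then have "(\<lambda>x. (3 / gap\<^sup>2) powr (3 / 2) * (case x of (m, n) \<Rightarrow> q m * q n)) summable_on (UNIV - {(0, 0)})"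
    by (rule summable_on_cmult_right[OF summable_on_subset_banach]) auto
  then have "(\<lambda>x. 1 / norm (h x) ^ 3) summable_on (UNIV - {(0, 0)})"
  proof (rule summable_on_comparison_test)
    fix x :: "int \<times> int" assume x: "x \<in> UNIV - {(0, 0)}"
    obtain m n where mn: "x = (m, n)" by (cases x)
    define S where "S = (real_of_int m)\<^sup>2 + (real_of_int n)\<^sup>2"
    have "1 \<le> m\<^sup>2 + n\<^sup>2"
      using x mn by (auto simp: sum_power2_gt_zero_iff simp flip: zero_less_iff_neq_zero intro!: int_one_le_iff_zero_less[THEN iffD2])
    then have S1: "1 \<le> S" unfolding S_def by (metis of_int_1_le_iff of_int_add of_int_power)
    have gS: "gap\<^sup>2 * S \<le> (norm (h x))\<^sup>2"
    proof -
      have "gap\<^sup>2 \<le> (2 * A)\<^sup>2" "gap\<^sup>2 \<le> (2 * B)\<^sup>2"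
        using A_pos B_pos by (auto simp: gap_def intro!: power_mono)
      then have "gap\<^sup>2 * (real_of_int m)\<^sup>2 + gap\<^sup>2 * (real_of_int n)\<^sup>2
          \<le> (2 * A)\<^sup>2 * (real_of_int m)\<^sup>2 + (2 * B)\<^sup>2 * (real_of_int n)\<^sup>2"
        by (intro add_mono mult_right_mono) auto
      then show ?thesis by (simp add: S_def h_def mn cmod_power2 power_mult_distrib distrib_left)
    qed
    have "(1 + \<bar>real_of_int m\<bar>) * (1 + \<bar>real_of_int n\<bar>) \<le> 3 * S"
    proof -
      \<comment> \<open>The three squares give |m| |n| + |m| + |n| \<le> S + 1; adding 1 and using S
        \<ge> 1 turns the bound S + 2 into 3 S.\<close>
      have "0 \<le> (\<bar>real_of_int m\<bar> - \<bar>real_of_int n\<bar>)\<^sup>2 + (\<bar>real_of_int m\<bar> - 1)\<^sup>2 + (\<bar>real_of_int n\<bar> - 1)\<^sup>2"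
        by simp
      then have "2 * (\<bar>real_of_int m\<bar> * \<bar>real_of_int n\<bar> + \<bar>real_of_int m\<bar> + \<bar>real_of_int n\<bar>) \<le> 2 * S + 2"
        by (simp add: S_def power2_diff algebra_simps)
      then show ?thesis using S1 by (simp add: algebra_simps)
    qed
    also have "S \<le> (norm (h x))\<^sup>2 / gap\<^sup>2"
      using gS gap_pos by (simp add: pos_le_divide_eq mult.commute)
    finally have "(1 + \<bar>real_of_int m\<bar>) * (1 + \<bar>real_of_int n\<bar>) \<le> 3 / gap\<^sup>2 * (norm (h x))\<^sup>2"
      by simp
    then have "((1 + \<bar>real_of_int m\<bar>) * (1 + \<bar>real_of_int n\<bar>)) powr (3 / 2) \<le> (3 / gap\<^sup>2 * (norm (h x))\<^sup>2) powr (3 / 2)"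
      by (intro powr_mono2) auto
    also have "\<dots> = (3 / gap\<^sup>2) powr (3 / 2) * norm (h x) ^ 3"
    proof -
      have hx: "0 < norm (h x)" using x h0[of x] by simp
      then have "((norm (h x))\<^sup>2) powr (3 / 2) = norm (h x) ^ 3"
        by (simp add: powr_powr flip: powr_numeral)
      then show ?thesis by (subst powr_mult) simp_all
    qed
    finally have le: "((1 + \<bar>real_of_int m\<bar>) * (1 + \<bar>real_of_int n\<bar>)) powr (3 / 2) \<le> (3 / gap\<^sup>2) powr (3 / 2) * norm (h x) ^ 3" .
    have hx: "0 < norm (h x)" using x h0[of x] by simp
    define T where "T = ((1 + \<bar>real_of_int m\<bar>) * (1 + \<bar>real_of_int n\<bar>)) powr (3 / 2)"
    have T: "0 < T" "q m * q n = 1 / T"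
      unfolding T_def q_def powr_minus_divide by (auto simp: powr_mult)
    have "1 / norm (h x) ^ 3 \<le> (3 / gap\<^sup>2) powr (3 / 2) * (1 / T)"
      using le[folded T_def] hx T(1) by (simp add: divide_simps mult.commute)
    then show "1 / norm (h x) ^ 3 \<le> (3 / gap\<^sup>2) powr (3 / 2) * (case x of (m, n) \<Rightarrow> q m * q n)"
      unfolding mn prod.case T(2) by simp
  qed auto
  then show ?thesis
    unfolding img summable_on_reindex[OF inj_on_subset[OF inj subset_UNIV]] by (simp add: o_def)
qed

lemma summable_norm_L:
  assumes "3 \<le> k"
  shows "(\<lambda>w. 1 / norm w ^ k) summable_on (L - {0})"
proof (rule summable_on_comparison_test[OF summable_on_cmult_right[OF summable_norm_L3, of "1 / gap ^ (k - 3)"]])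
  fix w assume w: "w \<in> L - {0}"
  then have "gap ^ (k - 3) \<le> norm w ^ (k - 3)"
    using L_norm_ge gap_pos by (intro power_mono) auto
  then have "gap ^ (k - 3) * norm w ^ 3 \<le> norm w ^ (k - 3) * norm w ^ 3"
    by (intro mult_right_mono) auto
  also have "\<dots> = norm w ^ k" using assms by (simp flip: power_add)
  finally show "1 / norm w ^ k \<le> 1 / gap ^ (k - 3) * (1 / norm w ^ 3)"
    using w gap_pos by (simp add: divide_simps)
qed auto

text \<open>Lattice points of norm at least 2 R are at distance at least |w| / 2 from the disc,
  where R bounds the disc; the others keep distance r, and r is at least r / (2 R) times their norm.
  One constant c thus controls all terms near z, and z = 0 is allowed.\<close>

lemma L0_separation:
  assumes "z \<notin> L - {0}"
  obtains r c where "0 < r" "0 < c" "\<And>u w. u \<in> cball z r \<Longrightarrow> w \<in> L - {0} \<Longrightarrow> c * norm w \<le> norm (u - w)"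
proof -
  obtain e where e: "0 < e" "cball z e \<subseteq> - (L - {0})"
    using open_compl_L0 assms by (metis ComplI open_contains_cball_eq)
  define r where "r = e / 2"
  define R where "R = norm z + r"
  define c where "c = min (1/2) (r / (2 * R))"
  have r: "0 < r" using e by (simp add: r_def)
  have R: "0 < R" using r by (simp add: R_def add_nonneg_pos)
  have "c * norm w \<le> norm (u - w)" if u: "u \<in> cball z r" and w: "w \<in> L - {0}" for u w
  proof (cases "2 * R \<le> norm w")
    case True
    have "norm u \<le> R"
      using u norm_triangle_sub[of u z] by (simp add: R_def dist_norm norm_minus_commute)
    then have "norm w / 2 \<le> norm (u - w)"
      using True norm_triangle_ineq2[of w u] by (simp add: norm_minus_commute)
    moreover have "c * norm w \<le> 1/2 * norm w"
      by (intro mult_right_mono) (auto simp: c_def)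
    ultimately show ?thesis by simp
  next
    case False
    have "\<not> dist z w \<le> e" using w e by auto
    then have "r \<le> norm (u - w)"
      using u dist_triangle[of z w u] by (simp add: r_def dist_norm)
    moreover have "c * norm w \<le> r / (2 * R) * (2 * R)"
      using False r R by (intro mult_mono) (auto simp: c_def)
    ultimately show ?thesis using R by simp
  qed
  moreover have "0 < c" using r R by (simp add: c_def)
  ultimately show ?thesis using that r by blast
qed

text \<open>The M-test makes the finite partial sums converge uniformly near z, and Weierstrass's
  theorem on uniform limits of holomorphic functions then gives the convergence of the
  differentiated series. A majorant is required for the terms \<open>f\<close> only.\<close>

lemma L0_series_has_derivative:
  fixes f f' :: "complex \<Rightarrow> complex \<Rightarrow> complex"
  assumes z: "z \<notin> L - {0}"
    and f: "\<And>w u. w \<in> L - {0} \<Longrightarrow> u \<noteq> w \<Longrightarrow> (f w has_field_derivative f' w u) (at u)"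
    and bound: "\<And>r c. 0 < r \<Longrightarrow> 0 < c \<Longrightarrow> \<exists>C. \<forall>u\<in>cball z r. \<forall>w\<in>L - {0}. c * norm w \<le> norm (u - w)
                      \<longrightarrow> norm (f w u) \<le> C * (1 / norm w ^ 3)"
  shows "((\<lambda>u. \<Sum>\<^sub>\<infinity>w\<in>L - {0}. f w u) has_field_derivative (\<Sum>\<^sub>\<infinity>w\<in>L - {0}. f' w z)) (at z)"
proof -
  obtain r c where r: "0 < r" "0 < c"
    and c: "\<And>u w. u \<in> cball z r \<Longrightarrow> w \<in> L - {0} \<Longrightarrow> c * norm w \<le> norm (u - w)"
    using L0_separation[OF z] by metis
  obtain C where C: "\<And>u w. u \<in> cball z r \<Longrightarrow> w \<in> L - {0} \<Longrightarrow> norm (f w u) \<le> C * (1 / norm w ^ 3)"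
    using bound[OF r] c by metis
  have ne: "u \<noteq> w" if "u \<in> cball z r" "w \<in> L - {0}" for u w
    using c[OF that] that mult_pos_pos[OF r(2), of "norm w"] by auto
  have unif: "uniform_limit (cball z r) (\<lambda>X u. \<Sum>w\<in>X. f w u) (\<lambda>u. \<Sum>\<^sub>\<infinity>w\<in>L - {0}. f w u) (finite_subsets_at_top (L - {0}))"
    by (rule Weierstrass_m_test_general[OF C summable_on_cmult_right[OF summable_norm_L3]])
  have ev: "\<forall>\<^sub>F X in finite_subsets_at_top (L - {0}). continuous_on (cball z r) (\<lambda>u. \<Sum>w\<in>X. f w u) \<and>
      (\<forall>u\<in>ball z r. ((\<lambda>u. \<Sum>w\<in>X. f w u) has_field_derivative (\<Sum>w\<in>X. f' w u)) (at u))"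
  proof (rule eventually_finite_subsets_at_top_weakI, intro conjI ballI)
    fix X assume X: "finite X" "X \<subseteq> L - {0}"
    show "continuous_on (cball z r) (\<lambda>u. \<Sum>w\<in>X. f w u)"
    proof (intro continuous_on_sum)
      fix w assume "w \<in> X"
      show "continuous_on (cball z r) (f w)"
        by (rule DERIV_continuous_on[OF has_field_derivative_at_within[OF f]]) (use X ne \<open>w \<in> X\<close> in auto)
    qed
    fix u assume u: "u \<in> ball z r"
    show "((\<lambda>u. \<Sum>w\<in>X. f w u) has_field_derivative (\<Sum>w\<in>X. f' w u)) (at u)"
    proof (rule DERIV_sum)
      fix w assume "w \<in> X"
      then have w: "w \<in> L - {0}" using X by blast
      show "(f w has_field_derivative f' w u) (at u)"
        by (rule f[OF w ne[OF _ w]]) (use u in simp)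
    qed
  qed
  obtain g' where g': "\<forall>u\<in>ball z r. ((\<lambda>u. \<Sum>\<^sub>\<infinity>w\<in>L - {0}. f w u) has_field_derivative g' u) (at u) \<and>
      ((\<lambda>X. \<Sum>w\<in>X. f' w u) \<longlongrightarrow> g' u) (finite_subsets_at_top (L - {0}))"
    using has_complex_derivative_uniform_limit[OF ev unif _ r(1)] finite_subsets_at_top_neq_bot by metis
  have "((\<lambda>w. f' w z) has_sum g' z) (L - {0})"
    using g' r by (simp add: has_sum_def)
  then have "g' z = (\<Sum>\<^sub>\<infinity>w\<in>L - {0}. f' w z)" by (simp add: infsumI)
  then show ?thesis using g' r by (metis centre_in_ball)
qed

text \<open>Leaving out w = 0 makes these sums holomorphic at 0, where they are Eisenstein sums. The
  exponent 2 lacks absolute convergence without the correction 1 / w^2, which is why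
  \<open>wp_reg\<close> is a separate definition.\<close>

definition E :: "nat \<Rightarrow> complex \<Rightarrow> complex" where
  "E k z = (\<Sum>\<^sub>\<infinity>w\<in>L - {0}. 1 / (z - w) ^ k)"

definition wp_reg :: "complex \<Rightarrow> complex" where
  "wp_reg z = (\<Sum>\<^sub>\<infinity>w\<in>L - {0}. 1 / (z - w) ^ 2 - 1 / w ^ 2)"

lemma E_has_derivative:
  assumes "3 \<le> k" "z \<notin> L - {0}"
  shows "(E k has_field_derivative - of_nat k * E (Suc k) z) (at z)"
proof -
  have "((\<lambda>u. \<Sum>\<^sub>\<infinity>w\<in>L - {0}. 1 / (u - w) ^ k) has_field_derivative
          (\<Sum>\<^sub>\<infinity>w\<in>L - {0}. - of_nat k * (1 / (z - w) ^ Suc k))) (at z)"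
  proof (rule L0_series_has_derivative[OF assms(2)])
    fix w u :: complex assume "u \<noteq> w"
    then show "((\<lambda>u. 1 / (u - w) ^ k) has_field_derivative - of_nat k * (1 / (u - w) ^ Suc k)) (at u)"
      using assms by (intro has_field_derivative_inverse_power) auto
  next
    fix r c :: real assume rc: "0 < r" "0 < c"
    show "\<exists>C. \<forall>u\<in>cball z r. \<forall>w\<in>L - {0}. c * norm w \<le> norm (u - w)
             \<longrightarrow> norm (1 / (u - w) ^ k) \<le> C * (1 / norm w ^ 3)"
    proof (intro exI ballI impI)
      fix u w assume w: "w \<in> L - {0}" and le: "c * norm w \<le> norm (u - w)"
      have "gap ^ (k - 3) * norm w ^ 3 \<le> norm w ^ (k - 3) * norm w ^ 3"
        using L_norm_ge gap_pos w by (intro mult_right_mono power_mono) auto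
      also have "\<dots> = norm w ^ k" using assms by (simp flip: power_add)
      finally have "c ^ k * (gap ^ (k - 3) * norm w ^ 3) \<le> c ^ k * norm w ^ k"
        using rc by (intro mult_left_mono) auto
      also have "\<dots> \<le> norm (u - w) ^ k"
        using power_mono[OF le, of k] rc by (simp add: power_mult_distrib)
      finally have "1 / norm (u - w) ^ k \<le> 1 / (c ^ k * (gap ^ (k - 3) * norm w ^ 3))"
        using w rc gap_pos less_le_trans[OF mult_pos_pos[OF rc(2), of "norm w"] le]
        by (intro divide_left_mono mult_pos_pos zero_less_power) auto
      then show "norm (1 / (u - w) ^ k) \<le> 1 / (c ^ k * gap ^ (k - 3)) * (1 / norm w ^ 3)"
        by (simp add: norm_divide norm_power)
    qed
  qed
  then show ?thesis
    unfolding E_def[abs_def] infsum_cmult_right' .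
qed

lemma wp_reg_has_derivative:
  assumes "z \<notin> L - {0}"
  shows "(wp_reg has_field_derivative - 2 * E 3 z) (at z)"
proof -
  have "((\<lambda>u. \<Sum>\<^sub>\<infinity>w\<in>L - {0}. 1 / (u - w) ^ 2 - 1 / w ^ 2) has_field_derivative
          (\<Sum>\<^sub>\<infinity>w\<in>L - {0}. - 2 * (1 / (z - w) ^ 3))) (at z)"
  proof (rule L0_series_has_derivative[OF assms])
    fix w u :: complex assume "u \<noteq> w"
    then show "((\<lambda>u. 1 / (u - w) ^ 2 - 1 / w ^ 2) has_field_derivative - 2 * (1 / (u - w) ^ 3)) (at u)"
      using DERIV_diff[OF has_field_derivative_inverse_power[of 2 u w] DERIV_const[of "1 / w ^ 2"]]
      by (simp add: numeral_3_eq_3)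
  next
    fix r c :: real assume rc: "0 < r" "0 < c"
    define R where "R = norm z + r"
    show "\<exists>C. \<forall>u\<in>cball z r. \<forall>w\<in>L - {0}. c * norm w \<le> norm (u - w)
             \<longrightarrow> norm (1 / (u - w) ^ 2 - 1 / w ^ 2) \<le> C * (1 / norm w ^ 3)"
    proof (intro exI ballI impI)
      fix u w assume u: "u \<in> cball z r" and w: "w \<in> L - {0}" and le: "c * norm w \<le> norm (u - w)"
      define D where "D = norm (u - w)"
      define N where "N = norm w"
      have N: "0 < N" and D: "0 < D" "c * N \<le> D"
        using w rc le less_le_trans[OF mult_pos_pos, of c "norm w" "norm (u - w)"] by (auto simp: N_def D_def)
      have uR: "norm u \<le> R"
        using u norm_triangle_sub[of u z] by (simp add: R_def dist_norm norm_minus_commute)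
      have "u - w \<noteq> 0" "w \<noteq> 0" using D w by (auto simp: D_def)
      \<comment> \<open>The numerator is u (2 w - u), of first order in w, so the difference decays
        like |w|^(-3) instead of |w|^(-2).\<close>
      then have "1 / (u - w) ^ 2 - 1 / w ^ 2 = u * (w - (u - w)) / ((u - w) ^ 2 * w ^ 2)"
        by (simp add: divide_simps) (simp add: algebra_simps power2_eq_square)
      then have "norm (1 / (u - w) ^ 2 - 1 / w ^ 2) = norm u * norm (w - (u - w)) / (D ^ 2 * N ^ 2)"
        by (simp add: norm_mult norm_divide norm_power D_def N_def)
      also have "\<dots> \<le> R * (N + D) / (D ^ 2 * N ^ 2)"
        using uR norm_triangle_ineq4[of w "u - w"] N D
        by (intro divide_right_mono mult_mono) (auto simp: N_def D_def R_def rc less_imp_le intro: order_trans[OF norm_ge_zero])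
      also have "\<dots> = R / N ^ 2 * (N * (1 / D ^ 2) + 1 / D)"
        using N D by (simp add: field_simps power2_eq_square)
      also have "\<dots> \<le> R / N ^ 2 * (N * (1 / (c * N) ^ 2) + 1 / (c * N))"
      proof (intro mult_left_mono add_mono divide_left_mono power_mono)
        show "0 \<le> R / N ^ 2" using rc by (simp add: R_def)
      qed (use N D rc in auto)
      also have "\<dots> = R * (1 / c ^ 2 + 1 / c) * (1 / N ^ 3)"
        using N rc by (simp add: field_simps power2_eq_square power3_eq_cube)
      finally show "norm (1 / (u - w) ^ 2 - 1 / w ^ 2) \<le> R * (1 / c ^ 2 + 1 / c) * (1 / norm w ^ 3)"
        by (simp add: N_def)
    qed
  qed
  then show ?thesis
    unfolding wp_reg_def[abs_def] E_def[abs_def] infsum_cmult_right' .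
qed

end

text \<open>By the Leibniz rule, the equation expresses each derivative of order m + 2 at z0 through
  those of order at most m, so all of them vanish; the identity theorem carries this over the
  connected set S.\<close>

lemma linear_ode_unique:
  fixes d q :: "complex \<Rightarrow> complex"
  assumes d: "d holomorphic_on S" and q: "q holomorphic_on S" and S: "open S" "connected S"
    and ode: "\<And>z. z \<in> S \<Longrightarrow> deriv (deriv d) z = q z * d z"
    and init: "z0 \<in> S" "d z0 = 0" "deriv d z0 = 0"
    and z: "z \<in> S"
  shows "d z = 0"
proof -
  have "(deriv ^^ n) d z0 = 0" for n
  proof (induction n rule: less_induct)
    case (less n)
    show ?case
    proof (cases "n < 2")
      case True
      then consider "n = 0" | "n = 1" by linarith
      then show ?thesis using init by cases auto
    next
      case False
      then obtain m where n: "n = m + 2" using le_Suc_ex[of 2 n] by (auto simp: add.commute)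
      have "(deriv ^^ n) d z0 = (deriv ^^ m) (deriv (deriv d)) z0"
        by (simp add: n funpow_swap1)
      also have "\<dots> = (deriv ^^ m) (\<lambda>z. q z * d z) z0"
        using d q S init ode
        by (intro higher_deriv_transform_within_open[of _ S]) (auto intro!: holomorphic_intros)
      also have "\<dots> = (\<Sum>i = 0..m. of_nat (m choose i) * (deriv ^^ i) q z0 * (deriv ^^ (m - i)) d z0)"
        using higher_deriv_mult[OF q d S(1) init(1)] .
      also have "\<dots> = 0"
        by (intro sum.neutral ballI) (use less n in auto)
      finally show ?thesis .
    qed
  qed
  then show ?thesis
    using holomorphic_fun_eq_0_on_connected[OF d S _ init(1) z] by blast
qed

context rect_lattice
begin

section \<open>Derivatives, parity and periodicity of the Weierstrass function\<close>

abbreviation wp :: "complex \<Rightarrow> complex" where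
  "wp \<equiv> weierstrass_p L"

definition wp_deriv :: "complex \<Rightarrow> complex" where
  "wp_deriv z = - 2 / z ^ 3 - 2 * E 3 z"

definition wp_deriv2 :: "complex \<Rightarrow> complex" where
  "wp_deriv2 z = 6 / z ^ 4 + 6 * E 4 z"

lemma wp_eq: "wp z = 1 / z ^ 2 + wp_reg z"
  by (simp add: weierstrass_p_def wp_reg_def)

lemma not_L_imp: "z \<notin> L \<Longrightarrow> z \<noteq> 0" "z \<notin> L \<Longrightarrow> z \<notin> L - {0}"
  by auto

lemma wp_has_derivative:
  assumes "z \<notin> L"
  shows "(wp has_field_derivative wp_deriv z) (at z)"
proof -
  have "((\<lambda>z. 1 / (z - 0) ^ 2 + wp_reg z) has_field_derivative - of_nat 2 * (1 / (z - 0) ^ Suc 2) + - 2 * E 3 z) (at z)"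
    by (intro DERIV_add has_field_derivative_inverse_power wp_reg_has_derivative) (use assms not_L_imp in auto)
  then show ?thesis
    by (simp add: wp_eq[abs_def] wp_deriv_def numeral_3_eq_3 numeral_2_eq_2)
qed

lemma wp_deriv_has_derivative:
  assumes "z \<notin> L"
  shows "(wp_deriv has_field_derivative wp_deriv2 z) (at z)"
proof -
  have "((\<lambda>z. - 2 * (1 / (z - 0) ^ 3) - 2 * E 3 z) has_field_derivative
      - 2 * (- of_nat 3 * (1 / (z - 0) ^ Suc 3)) - 2 * (- of_nat 3 * E (Suc 3) z)) (at z)"
    by (intro DERIV_diff DERIV_cmult has_field_derivative_inverse_power E_has_derivative)
       (use assms not_L_imp in auto)
  then show ?thesis
    by (simp add: wp_deriv_def[abs_def] wp_deriv2_def)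
qed

lemma summable_E:
  assumes "3 \<le> k" "z \<notin> L"
  shows "(\<lambda>w. 1 / (z - w) ^ k) summable_on L - {0}"
proof -
  obtain r c where c: "0 < r" "0 < c" "\<And>u w. u \<in> cball z r \<Longrightarrow> w \<in> L - {0} \<Longrightarrow> c * norm w \<le> norm (u - w)"
    using L0_separation[of z] assms by blast
  show ?thesis
  proof (rule abs_summable_summable, rule summable_on_comparison_test)
    show "(\<lambda>w. 1 / c ^ k * (1 / norm w ^ k)) summable_on L - {0}"
      by (rule summable_on_cmult_right[OF summable_norm_L[OF assms(1)]])
    fix w assume w: "w \<in> L - {0}"
    have le: "c * norm w \<le> norm (z - w)" by (rule c(3)[OF _ w]) (use c in simp)
    have pos: "0 < c * norm w" using w c by simp
    have "1 / norm (z - w) ^ k \<le> 1 / (c * norm w) ^ k"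
      using less_le_trans[OF pos le] pos le by (intro divide_left_mono power_mono mult_pos_pos[OF zero_less_power zero_less_power]) auto
    then show "norm (1 / (z - w) ^ k) \<le> 1 / c ^ k * (1 / norm w ^ k)"
      by (simp add: norm_divide norm_power power_mult_distrib)
  qed auto
qed

lemma infsum_L_eq:
  assumes "3 \<le> k" "z \<notin> L"
  shows "(\<Sum>\<^sub>\<infinity>w\<in>L. 1 / (z - w) ^ k) = 1 / z ^ k + E k z"
proof -
  have "((\<lambda>w. 1 / (z - w) ^ k) has_sum (1 / (z - 0) ^ k + E k z)) (insert 0 (L - {0}))"
    unfolding E_def by (intro has_sum_insert has_sum_infsum summable_E assms) auto
  then show ?thesis by (simp add: infsumI insert_absorb)
qed

lemma wp_deriv_eq: "z \<notin> L \<Longrightarrow> wp_deriv z = - 2 * (\<Sum>\<^sub>\<infinity>w\<in>L. 1 / (z - w) ^ 3)"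
  by (simp add: wp_deriv_def infsum_L_eq algebra_simps)

lemma wp_deriv2_eq: "z \<notin> L \<Longrightarrow> wp_deriv2 z = 6 * (\<Sum>\<^sub>\<infinity>w\<in>L. 1 / (z - w) ^ 4)"
  by (simp add: wp_deriv2_def infsum_L_eq algebra_simps)

text \<open>A sum over the whole group L, with the term at 0 restored, is invariant under
  translation by reindexing. This handles the derivatives; for \<open>wp\<close> itself the terms 1
  / w^2 obstruct it.\<close>

lemma infsum_L_periodic:
  assumes "w0 \<in> L"
  shows "(\<Sum>\<^sub>\<infinity>w\<in>L. f (z + w0 - w)) = (\<Sum>\<^sub>\<infinity>w\<in>L. f (z - w))"
  by (rule infsum_reindex_bij_witness[of _ "\<lambda>w. w + w0" "\<lambda>w. w - w0"])
     (use assms in \<open>auto simp: L_add_iff L_diff_iff algebra_simps\<close>)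

lemma wp_deriv_periodic: "z \<notin> L \<Longrightarrow> w0 \<in> L \<Longrightarrow> wp_deriv (z + w0) = wp_deriv z"
  using infsum_L_periodic[of w0 "\<lambda>u. 1 / u ^ 3" z] by (simp add: wp_deriv_eq L_add_iff)

lemma wp_deriv2_periodic: "z \<notin> L \<Longrightarrow> w0 \<in> L \<Longrightarrow> wp_deriv2 (z + w0) = wp_deriv2 z"
  using infsum_L_periodic[of w0 "\<lambda>u. 1 / u ^ 4" z] by (simp add: wp_deriv2_eq L_add_iff)

lemma wp_even: "wp (- z) = wp z"
proof -
  have "wp_reg (- z) = wp_reg z"
    unfolding wp_reg_def
    by (rule infsum_reindex_bij_witness[of _ uminus uminus])
       (auto simp: power2_commute power2_minus algebra_simps)
  then show ?thesis by (simp add: wp_eq)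
qed

lemma E_minus: "E k (- z) = (-1) ^ k * E k z"
proof -
  have "E k (- z) = (\<Sum>\<^sub>\<infinity>w\<in>L - {0}. (-1) ^ k * (1 / (z - w) ^ k))"
    unfolding E_def
  proof (rule infsum_reindex_bij_witness[of _ uminus uminus])
    fix w :: complex
    have "- z - w = - (z - - w)" by simp
    then have "(- z - w) ^ k = (-1) ^ k * (z - - w) ^ k" by (metis power_minus)
    then show "(-1) ^ k * (1 / (z - - w) ^ k) = 1 / (- z - w) ^ k"
      by (cases "even k") auto
  qed auto
  then show ?thesis by (simp only: E_def infsum_cmult_right')
qed

lemma wp_deriv_odd: "wp_deriv (- z) = - wp_deriv z"
  by (simp add: wp_deriv_def E_minus)

lemma wp_cnj: "wp (cnj z) = cnj (wp z)"
proof -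
  have "wp_reg (cnj z) = (\<Sum>\<^sub>\<infinity>w\<in>L - {0}. cnj (1 / (z - w) ^ 2 - 1 / w ^ 2))"
    unfolding wp_reg_def
    by (rule infsum_reindex_bij_witness[of _ cnj cnj]) auto
  then show ?thesis by (simp add: wp_eq wp_reg_def del: complex_cnj_divide complex_cnj_diff) simp
qed

text \<open>The difference wp (z + w0) - wp z has derivative 0 on the connected complement of L, so
  it is constant; evenness makes it change sign under z \<mapsto> - w0 - z. This reflection works at
  any z, whereas the point - w0 / 2 may itself lie in L.\<close>

lemma wp_periodic:
  assumes "z \<notin> L" "w0 \<in> L"
  shows "wp (z + w0) = wp z"
proof -
  define F where "F z = wp (z + w0) - wp z" for z
  have der: "(F has_field_derivative 0) (at u)" if u: "u \<notin> L" for u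
  proof -
    have "u + w0 \<notin> L" using u assms by (simp add: L_add_iff)
    then have "((\<lambda>z. wp (z + w0)) has_field_derivative wp_deriv (u + w0) * 1) (at u)"
      by (intro DERIV_chain2[OF wp_has_derivative]) (auto intro!: derivative_eq_intros)
    from DERIV_diff[OF this wp_has_derivative[OF u]] show ?thesis
      using u assms by (simp add: F_def[abs_def] wp_deriv_periodic)
  qed
  have "F constant_on - L"
  proof (rule DERIV_zero_connected_constant_on[OF connected_compl_L open_compl_L finite.emptyI])
    show "continuous_on (- L) F"
      by (rule DERIV_continuous_on[OF has_field_derivative_at_within[OF der]]) auto
  qed (use der in auto)
  then obtain c where c: "\<And>u. u \<notin> L \<Longrightarrow> F u = c"
    by (auto simp: constant_on_def)
  have "- w0 - z \<notin> L" using assms L_add_iff[of w0 z] L_minus_iff[of "z + w0"] by (simp add: algebra_simps)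
  then have "F (- w0 - z) = F z" using c assms by simp
  moreover have "F (- w0 - z) = - F z"
    using wp_even[of z] wp_even[of "z + w0"] by (simp add: F_def algebra_simps)
  ultimately show ?thesis by (simp add: F_def)
qed

text \<open>The limit removes the singularity at 0, and translation removes those at the other
  lattice points. The resulting entire function is determined by its values on one compact period
  rectangle, so Liouville's theorem makes it constant, equal to its value 0 at 0.\<close>

lemma periodic_holomorphic_eq_0:
  fixes F :: "complex \<Rightarrow> complex"
  assumes hol: "F holomorphic_on - L"
    and per: "\<And>z w. z \<notin> L \<Longrightarrow> w \<in> L \<Longrightarrow> F (z + w) = F z"
    and lim: "(F \<longlongrightarrow> 0) (at 0)"
    and z: "z \<notin> L"
  shows "F z = 0"
proof -
  define H where "H z = (if z \<in> L then 0 else F z)" for z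
  have Hper: "H (z + w) = H z" if "w \<in> L" for z w
    using that per by (simp add: H_def L_add_iff)
  have ball_L: "ball 0 gap \<inter> L \<subseteq> {0}" using L_norm_ge by force
  have hol_L: "H holomorphic_on - L"
    by (rule holomorphic_transform[OF hol]) (simp add: H_def)
  have hol_0: "H holomorphic_on ball 0 gap"
  proof (rule no_isolated_singularity'[where K = "{0}"])
    have "\<forall>\<^sub>F z in at 0. F z = H z"
      using ball_L gap_pos by (auto simp: eventually_at H_def dist_norm intro!: exI[of _ gap])
    from Lim_transform_eventually[OF lim this] have "(H \<longlongrightarrow> 0) (at 0)" .
    from tendsto_within_subset[OF this, of "ball 0 gap"]
    show "(H \<longlongrightarrow> H u) (at u within ball 0 gap)" if "u \<in> {0}" for u
      using that by (simp add: H_def)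
    show "H holomorphic_on ball 0 gap - {0}"
      by (rule holomorphic_on_subset[OF hol_L]) (use ball_L in auto)
  qed auto
  have diff: "H field_differentiable at u" for u
  proof (cases "u \<in> L")
    case False
    then show ?thesis
      using holomorphic_on_imp_differentiable_at[OF hol_L open_compl_L] by auto
  next
    case True
    have "H field_differentiable at (u + - u)"
      using holomorphic_on_imp_differentiable_at[OF hol_0] gap_pos by simp
    moreover have "(\<lambda>z. z + - u) field_differentiable at u"
      by (intro derivative_intros)
    ultimately have "H \<circ> (\<lambda>z. z + - u) field_differentiable at u"
      by (intro field_differentiable_compose)
    moreover have "H \<circ> (\<lambda>z. z + - u) = H"
      using Hper[of "- u"] True by (auto simp: o_def)
    ultimately show ?thesis by simp
  qed
  then have holH: "H holomorphic_on UNIV"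
    by (simp add: holomorphic_on_def)
  have "range H \<subseteq> H ` cbox 0 (Complex (2 * A) (2 * B))"
  proof safe
    fix u
    define m where "m = \<lfloor>Re u / (2 * A)\<rfloor>"
    define n where "n = \<lfloor>Im u / (2 * B)\<rfloor>"
    define w where "w = Complex (2 * A * m) (2 * B * n)"
    have w: "w \<in> L" unfolding w_def Complex_in_L_iff by blast
    have "0 \<le> Re u - 2 * A * m" "Re u - 2 * A * m \<le> 2 * A"
      using A_pos floor_correct[of "Re u / (2 * A)"] unfolding m_def[symmetric] by (simp_all add: field_simps)
    moreover have "0 \<le> Im u - 2 * B * n" "Im u - 2 * B * n \<le> 2 * B"
      using B_pos floor_correct[of "Im u / (2 * B)"] unfolding n_def[symmetric] by (simp_all add: field_simps)
    ultimately have "u - w \<in> cbox 0 (Complex (2 * A) (2 * B))"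
      by (simp add: in_cbox_complex_iff w_def)
    moreover have "H u = H (u - w)" using Hper[OF w, of "u - w"] by simp
    ultimately show "H u \<in> H ` cbox 0 (Complex (2 * A) (2 * B))" by blast
  qed
  moreover have "bounded (H ` cbox 0 (Complex (2 * A) (2 * B)))"
    using holH by (intro compact_imp_bounded compact_continuous_image
       holomorphic_on_imp_continuous_on) (auto intro: holomorphic_on_subset)
  ultimately have "bounded (range H)" by (rule bounded_subset[rotated])
  with holH have "H constant_on UNIV" by (rule Liouville_theorem)
  then have "H z = H 0" by (auto simp: constant_on_def)
  with z show ?thesis by (simp add: H_def)
qed

section \<open>Laurent expansion at 0 and the differential equations\<close>

definition G4 :: complex where "G4 = (\<Sum>\<^sub>\<infinity>w\<in>L - {0}. 1 / w ^ 4)"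
definition G6 :: complex where "G6 = (\<Sum>\<^sub>\<infinity>w\<in>L - {0}. 1 / w ^ 6)"

lemma E_at_0: "E 4 0 = G4" "E 6 0 = G6" "odd k \<Longrightarrow> E k 0 = 0"
  using E_minus[of k 0] by (auto simp: E_def G4_def G6_def)

lemma wp_reg_0: "wp_reg 0 = 0"
  by (simp add: wp_reg_def)

text \<open>A closed form of the i-th derivative of \<open>wp_reg\<close>; i = 0 is separate because
  it would involve the exponent 2. It supplies the Taylor coefficients at 0, where the odd
  Eisenstein sums vanish.\<close>

definition wp_reg_derivs :: "nat \<Rightarrow> complex \<Rightarrow> complex" where
  "wp_reg_derivs i = (if i = 0 then wp_reg else (\<lambda>z. (-1) ^ i * fact (Suc i) * E (i + 2) z))"

lemma wp_reg_derivs_has_derivative: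
  assumes "z \<notin> L - {0}"
  shows "(wp_reg_derivs i has_field_derivative wp_reg_derivs (Suc i) z) (at z)"
proof (cases "i = 0")
  case True
  then show ?thesis
    using wp_reg_has_derivative[OF assms] by (simp add: wp_reg_derivs_def numeral_3_eq_3 numeral_2_eq_2)
next
  case False
  have "((\<lambda>z. (-1) ^ i * fact (Suc i) * E (i + 2) z) has_field_derivative
      (-1) ^ i * fact (Suc i) * (- of_nat (i + 2) * E (Suc (i + 2)) z)) (at z)"
    by (intro DERIV_cmult E_has_derivative assms) (use False in auto)
  moreover have "(-1) ^ i * fact (Suc i) * (- of_nat (i + 2) * E (Suc (i + 2)) z)
     = (-1) ^ Suc i * fact (Suc (Suc i)) * E (Suc i + 2) z"
    by (simp only: fact_Suc[of "Suc i"] power_Suc) (simp add: algebra_simps)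
  moreover have "wp_reg_derivs i = (\<lambda>z. (-1) ^ i * fact (Suc i) * E (i + 2) z)"
    "wp_reg_derivs (Suc i) z = (-1) ^ Suc i * fact (Suc (Suc i)) * E (Suc i + 2) z"
    using False by (simp_all only: wp_reg_derivs_def if_False nat.distinct)
  ultimately show ?thesis by (simp only:)
qed

lemma wp_reg_derivs_Taylor:
  obtains C where "\<And>z. norm z \<le> gap / 2 \<Longrightarrow>
    norm (wp_reg_derivs j z - (\<Sum>i\<le>n. wp_reg_derivs (j + i) 0 * z ^ i / fact i)) \<le> C * norm z ^ Suc n"
proof -
  have S: "z \<notin> L - {0}" if "z \<in> cball 0 (gap / 2)" for z
    using that L_norm_ge[of z] gap_pos by auto
  have "continuous_on (cball 0 (gap / 2)) (wp_reg_derivs (j + Suc n))"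
    by (rule DERIV_continuous_on[OF has_field_derivative_at_within[OF wp_reg_derivs_has_derivative[OF S]]])
  then have "bounded (wp_reg_derivs (j + Suc n) ` cball 0 (gap / 2))"
    by (intro compact_imp_bounded compact_continuous_image) auto
  then obtain M where M: "\<And>z. z \<in> cball 0 (gap / 2) \<Longrightarrow> norm (wp_reg_derivs (j + Suc n) z) \<le> M"
    by (metis bounded_iff imageI)
  show ?thesis
  proof (rule that[of "M / fact n"])
    fix z :: complex assume z: "norm z \<le> gap / 2"
    have "norm (wp_reg_derivs (j + 0) z - (\<Sum>i\<le>n. wp_reg_derivs (j + i) 0 * (z - 0) ^ i / fact i)) \<le> M * norm (z - 0) ^ Suc n / fact n"
    proof (rule complex_Taylor[where f = "\<lambda>i. wp_reg_derivs (j + i)" and S = "cball 0 (gap / 2)"])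
      show "(wp_reg_derivs (j + i) has_field_derivative wp_reg_derivs (j + Suc i) x) (at x within cball 0 (gap / 2))"
        if "x \<in> cball 0 (gap / 2)" for i x
        using wp_reg_derivs_has_derivative[OF S[OF that], of "j + i"] by (simp add: has_field_derivative_at_within)
    qed (use M z gap_pos in auto)
    then show "norm (wp_reg_derivs j z - (\<Sum>i\<le>n. wp_reg_derivs (j + i) 0 * z ^ i / fact i)) \<le> M / fact n * norm z ^ Suc n"
      by simp
  qed
qed

lemma tendsto_0_of_bound:
  fixes f :: "complex \<Rightarrow> complex"
  assumes "\<And>z. norm z \<le> gap / 2 \<Longrightarrow> norm (f z) \<le> C * norm z ^ Suc n"
  shows "((\<lambda>z. f z / z ^ n) \<longlongrightarrow> 0) (at 0)"
proof (rule Lim_null_comparison)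
  show "((\<lambda>z::complex. C * norm z) \<longlongrightarrow> 0) (at 0)"
    by (auto intro!: tendsto_eq_intros)
  show "\<forall>\<^sub>F z in at 0. norm (f z / z ^ n) \<le> C * norm z"
    unfolding eventually_at
  proof (intro exI[of _ "gap / 2"] conjI ballI impI)
    fix z :: complex assume z: "z \<noteq> 0 \<and> dist z 0 < gap / 2"
    then have "norm (f z) \<le> C * norm z ^ Suc n" using assms[of z] by simp
    then show "norm (f z / z ^ n) \<le> C * norm z"
      using z by (simp add: norm_divide norm_power divide_simps mult_ac)
  qed (use gap_pos in auto)
qed

text \<open>The Taylor coefficients are 3! G4 / 2! = 3 G4 and 5! G6 / 4! = 5 G6. The orders 4 and 3
  are those at which the cross terms z^(-4) wp_reg of wp^3 and z^(-3) wp_reg' of wp'^2 still reach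
  the constant term.\<close>

lemma wp_reg_limits:
  shows "((\<lambda>z. (wp_reg z - 3 * G4 * z ^ 2 - 5 * G6 * z ^ 4) / z ^ 4) \<longlongrightarrow> 0) (at 0)"
    and "((\<lambda>z. (- 2 * E 3 z - 6 * G4 * z - 20 * G6 * z ^ 3) / z ^ 3) \<longlongrightarrow> 0) (at 0)"
proof -
  have derivs_0: "wp_reg_derivs 0 0 = 0" "wp_reg_derivs 1 0 = 0" "wp_reg_derivs 2 0 = 6 * G4"
    "wp_reg_derivs 3 0 = 0" "wp_reg_derivs 4 0 = 120 * G6"
    by (simp_all add: wp_reg_derivs_def wp_reg_0 E_at_0 fact_numeral)
  have atMost: "{..3::nat} = {0, 1, 2, 3}" "{..4::nat} = {0, 1, 2, 3, 4}" by auto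
  obtain C where C: "\<And>z. norm z \<le> gap / 2 \<Longrightarrow>
    norm (wp_reg_derivs 0 z - (\<Sum>i\<le>4. wp_reg_derivs (0 + i) 0 * z ^ i / fact i)) \<le> C * norm z ^ Suc 4"
    using wp_reg_derivs_Taylor[of 0 4] by blast
  have eq0: "wp_reg_derivs 0 z - (\<Sum>i\<le>4. wp_reg_derivs (0 + i) 0 * z ^ i / fact i)
      = wp_reg z - 3 * G4 * z ^ 2 - 5 * G6 * z ^ 4" for z
    by (simp add: atMost derivs_0 derivs_0(2)[unfolded One_nat_def] fact_numeral) (simp add: wp_reg_derivs_def)
  have "norm (wp_reg z - 3 * G4 * z ^ 2 - 5 * G6 * z ^ 4) \<le> C * norm z ^ Suc 4" if "norm z \<le> gap / 2" for z
    using C[OF that] by (simp only: eq0)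
  then show "((\<lambda>z. (wp_reg z - 3 * G4 * z ^ 2 - 5 * G6 * z ^ 4) / z ^ 4) \<longlongrightarrow> 0) (at 0)"
    by (rule tendsto_0_of_bound)
  obtain C where C: "\<And>z. norm z \<le> gap / 2 \<Longrightarrow>
    norm (wp_reg_derivs 1 z - (\<Sum>i\<le>3. wp_reg_derivs (1 + i) 0 * z ^ i / fact i)) \<le> C * norm z ^ Suc 3"
    using wp_reg_derivs_Taylor[of 1 3] by blast
  have eq1: "wp_reg_derivs 1 z - (\<Sum>i\<le>3. wp_reg_derivs (1 + i) 0 * z ^ i / fact i)
      = - 2 * E 3 z - 6 * G4 * z - 20 * G6 * z ^ 3" for z
    by (simp add: atMost derivs_0 derivs_0(2)[unfolded One_nat_def] derivs_0(3)[unfolded numeral_2_eq_2] fact_numeral)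
       (simp add: wp_reg_derivs_def numeral_3_eq_3)
  have "norm (- 2 * E 3 z - 6 * G4 * z - 20 * G6 * z ^ 3) \<le> C * norm z ^ Suc 3" if "norm z \<le> gap / 2" for z
    using C[OF that] by (simp only: eq1)
  then show "((\<lambda>z. (- 2 * E 3 z - 6 * G4 * z - 20 * G6 * z ^ 3) / z ^ 3) \<longlongrightarrow> 0) (at 0)"
    by (rule tendsto_0_of_bound)
qed

lemma E_tendsto: "3 \<le> k \<Longrightarrow> (E k \<longlongrightarrow> E k 0) (at 0)"
  using DERIV_isCont[OF E_has_derivative[of k 0]] by (simp add: isCont_def)

lemma wp_reg_tendsto: "(wp_reg \<longlongrightarrow> 0) (at 0)"
  using DERIV_isCont[OF wp_reg_has_derivative[of 0]] by (simp add: isCont_def wp_reg_0)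

lemma wp_reg_quadratic: "((\<lambda>z. wp_reg z / z ^ 2) \<longlongrightarrow> 3 * G4) (at 0)"
proof -
  have "((\<lambda>z. (wp_reg z - 3 * G4 * z ^ 2 - 5 * G6 * z ^ 4) / z ^ 4 * z ^ 2 + 3 * G4 + 5 * G6 * z ^ 2)
      \<longlongrightarrow> 0 * 0 ^ 2 + 3 * G4 + 5 * G6 * 0 ^ 2) (at 0)"
    by (intro tendsto_intros wp_reg_limits)
  moreover have "\<forall>\<^sub>F z in at 0. (wp_reg z - 3 * G4 * z ^ 2 - 5 * G6 * z ^ 4) / z ^ 4 * z ^ 2 + 3 * G4 + 5 * G6 * z ^ 2
      = wp_reg z / z ^ 2"
    using eventually_neq_at_within[of "0::complex"]
    by eventually_elim (simp add: field_simps eval_nat_numeral)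
  ultimately show ?thesis by (simp add: tendsto_cong)
qed

lemma wp_holomorphic [holomorphic_intros]: "wp holomorphic_on - L"
  and wp_deriv_holomorphic [holomorphic_intros]: "wp_deriv holomorphic_on - L"
  using wp_has_derivative wp_deriv_has_derivative
  by (auto simp: holomorphic_on_open[OF open_compl_L])

lemma wp_deriv2_holomorphic [holomorphic_intros]: "wp_deriv2 holomorphic_on - L"
proof (rule holomorphic_transform)
  show "deriv wp_deriv holomorphic_on - L"
    by (intro holomorphic_deriv wp_deriv_holomorphic open_compl_L)
  show "deriv wp_deriv z = wp_deriv2 z" if "z \<in> - L" for z
    using wp_deriv_has_derivative[of z] that by (simp add: DERIV_imp_deriv)
qed

lemma wp_ode:
  assumes "z \<notin> L"
  shows "(wp_deriv z)\<^sup>2 = 4 * wp z ^ 3 - 60 * G4 * wp z - 140 * G6"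
proof -
  define F where "F z = (wp_deriv z)\<^sup>2 - 4 * wp z ^ 3 + 60 * G4 * wp z + 140 * G6" for z
  have "F z = 0"
  proof (rule periodic_holomorphic_eq_0[OF _ _ _ assms])
    show "F holomorphic_on - L"
      unfolding F_def by (intro holomorphic_intros)
    show "F (z + w) = F z" if "z \<notin> L" "w \<in> L" for z w
      using that by (simp add: F_def wp_periodic wp_deriv_periodic)
    define s where "s z = (- 2 * E 3 z - 6 * G4 * z - 20 * G6 * z ^ 3) / z ^ 3" for z
    define r where "r z = (wp_reg z - 3 * G4 * z ^ 2 - 5 * G6 * z ^ 4) / z ^ 4" for z
    \<comment> \<open>This is F rewritten in quantities with known limits. The pole of order 6
      cancels, the coefficient of z^(-2) is (- 24 - 36 + 60) G4 = 0, and the constant is (- 80 - 60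
      + 140) G6 = 0.\<close>
    have "((\<lambda>z. - 4 * s z - 12 * r z + (- 2 * E 3 z)\<^sup>2 - 12 * (wp_reg z / z ^ 2) * wp_reg z
        - 4 * wp_reg z ^ 3 + 60 * G4 * wp_reg z) \<longlongrightarrow>
        - 4 * 0 - 12 * 0 + (- 2 * E 3 0)\<^sup>2 - 12 * (3 * G4) * 0 - 4 * 0 ^ 3 + 60 * G4 * 0) (at 0)"
      unfolding s_def r_def
      by (intro tendsto_intros wp_reg_limits wp_reg_tendsto wp_reg_quadratic E_tendsto) auto
    then have "((\<lambda>z. - 4 * s z - 12 * r z + (- 2 * E 3 z)\<^sup>2 - 12 * (wp_reg z / z ^ 2) * wp_reg z
        - 4 * wp_reg z ^ 3 + 60 * G4 * wp_reg z) \<longlongrightarrow> 0) (at 0)"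
      by (simp add: E_at_0(3))
    moreover have "\<forall>\<^sub>F z in at 0. - 4 * s z - 12 * r z + (- 2 * E 3 z)\<^sup>2 - 12 * (wp_reg z / z ^ 2) * wp_reg z
        - 4 * wp_reg z ^ 3 + 60 * G4 * wp_reg z = F z"
      using eventually_neq_at_within[of "0::complex"]
    proof eventually_elim
      fix z :: complex assume z: "z \<noteq> 0"
      define y where "y = 1 / z"
      have yz: "y * z = 1" using z by (simp add: y_def)
      have e: "s z = (- 2 * E 3 z - 6 * G4 * z - 20 * G6 * z ^ 3) * y ^ 3"
        "r z = (wp_reg z - 3 * G4 * z ^ 2 - 5 * G6 * z ^ 4) * y ^ 4"
        "wp_reg z / z ^ 2 = wp_reg z * y ^ 2"
        "wp z = y ^ 2 + wp_reg z" "wp_deriv z = - 2 * y ^ 3 - 2 * E 3 z"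
        by (simp_all add: s_def r_def y_def wp_eq wp_deriv_def power_divide)
      show "- 4 * s z - 12 * r z + (- 2 * E 3 z)\<^sup>2 - 12 * (wp_reg z / z ^ 2) * wp_reg z
        - 4 * wp_reg z ^ 3 + 60 * G4 * wp_reg z = F z"
        unfolding F_def e using yz by algebra
    qed
    ultimately show "(F \<longlongrightarrow> 0) (at 0)" by (rule Lim_transform_eventually)
  qed
  then show ?thesis by (simp add: F_def algebra_simps)
qed

text \<open>A second use of the Liouville argument. Differentiating \<open>wp_ode\<close> would give
  the equation multiplied by \<open>wp_deriv\<close>, which says nothing directly at the
  half-periods, where \<open>wp_deriv\<close> vanishes.\<close>

lemma wp_ode2:
  assumes "z \<notin> L"
  shows "wp_deriv2 z = 6 * (wp z)\<^sup>2 - 30 * G4"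
proof -
  define F where "F z = wp_deriv2 z - 6 * (wp z)\<^sup>2 + 30 * G4" for z
  have "F z = 0"
  proof (rule periodic_holomorphic_eq_0[OF _ _ _ assms])
    show "F holomorphic_on - L"
      unfolding F_def by (intro holomorphic_intros)
    show "F (z + w) = F z" if "z \<notin> L" "w \<in> L" for z w
      using that by (simp add: F_def wp_periodic wp_deriv2_periodic)
    have "((\<lambda>z. 6 * E 4 z - 12 * (wp_reg z / z ^ 2) - 6 * (wp_reg z)\<^sup>2 + 30 * G4) \<longlongrightarrow>
        6 * E 4 0 - 12 * (3 * G4) - 6 * 0\<^sup>2 + 30 * G4) (at 0)"
      by (intro tendsto_intros wp_reg_tendsto wp_reg_quadratic E_tendsto) auto
    then have "((\<lambda>z. 6 * E 4 z - 12 * (wp_reg z / z ^ 2) - 6 * (wp_reg z)\<^sup>2 + 30 * G4) \<longlongrightarrow> 0) (at 0)"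
      by (simp add: E_at_0)
    moreover have "\<forall>\<^sub>F z in at 0. 6 * E 4 z - 12 * (wp_reg z / z ^ 2) - 6 * (wp_reg z)\<^sup>2 + 30 * G4 = F z"
      using eventually_neq_at_within[of "0::complex"]
    proof eventually_elim
      fix z :: complex assume z: "z \<noteq> 0"
      define y where "y = 1 / z"
      have e: "wp_reg z / z ^ 2 = wp_reg z * y ^ 2"
        "wp z = y ^ 2 + wp_reg z" "wp_deriv2 z = 6 * y ^ 4 + 6 * E 4 z"
        by (simp_all add: y_def wp_eq wp_deriv2_def power_divide)
      show "6 * E 4 z - 12 * (wp_reg z / z ^ 2) - 6 * (wp_reg z)\<^sup>2 + 30 * G4 = F z"
        unfolding F_def e by algebra
    qed
    ultimately show "(F \<longlongrightarrow> 0) (at 0)" by (rule Lim_transform_eventually)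
  qed
  then show ?thesis by (simp add: F_def algebra_simps)
qed

lemma wp_at_infinity: "filterlim wp at_infinity (at 0)"
proof -
  have "filterlim (\<lambda>z::complex. inverse (z ^ 2)) at_infinity (at 0)"
    by (rule filterlim_compose[OF filterlim_inverse_at_infinity])
       (auto simp: filterlim_at eventually_at_filter intro!: tendsto_eq_intros)
  then have "filterlim (\<lambda>z. wp_reg z + inverse (z ^ 2)) at_infinity (at 0)"
    by (rule tendsto_add_filterlim_at_infinity[OF wp_reg_tendsto])
  then show ?thesis by (simp add: wp_eq[abs_def] divide_inverse add.commute)
qed

text \<open>If the functions z \<mapsto> wp (u + z) and z \<mapsto> wp (v \<plusminus> z) have the same value and
  derivative at 0, then they agree wherever both are defined, since both solve y'' = 6 y^2 - g2 / 2.
  Hence they have the same poles.\<close>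

lemma wp_eq_imp:
  assumes u: "u \<notin> L" and v: "v \<notin> L" and eps: "eps = 1 \<or> eps = -1"
    and eq: "wp u = wp v" and eq': "wp_deriv u = eps * wp_deriv v"
  shows "v - eps * u \<in> L"
proof (rule ccontr)
  assume not: "v - eps * u \<notin> L"
  have eps2: "eps * eps = 1" using eps by auto
  define S where "S = {z. u + z \<notin> L \<and> v + eps * z \<notin> L}"
  have S_eq: "S = - ((\<lambda>w. w - u) ` L \<union> (\<lambda>w. eps * (w - v)) ` L)"
  proof -
    have "u + z \<in> L \<longleftrightarrow> z \<in> (\<lambda>w. w - u) ` L" for z
      by (auto simp: image_iff intro!: bexI[of _ "u + z"])
    moreover have "v + eps * z \<in> L \<longleftrightarrow> z \<in> (\<lambda>w. eps * (w - v)) ` L" for z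
    proof
      assume "v + eps * z \<in> L"
      moreover have "z = eps * ((v + eps * z) - v)" using eps2 by (simp add: mult.assoc[symmetric])
      ultimately show "z \<in> (\<lambda>w. eps * (w - v)) ` L" by blast
    next
      assume "z \<in> (\<lambda>w. eps * (w - v)) ` L"
      then show "v + eps * z \<in> L" using eps2 by (auto simp: mult.assoc[symmetric])
    qed
    ultimately show ?thesis by (auto simp: S_def)
  qed
  have openS: "open S"
  proof -
    have "open ((\<lambda>z. u + z) -` (- L) \<inter> (\<lambda>z. v + eps * z) -` (- L))"
      by (intro open_Int open_vimage open_compl_L continuous_intros)
    also have "(\<lambda>z. u + z) -` (- L) \<inter> (\<lambda>z. v + eps * z) -` (- L) = S"
      by (auto simp: S_def)
    finally show ?thesis .
  qed
  have connS: "connected S"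
    unfolding S_eq
    by (intro path_connected_imp_connected path_connected_complement_countable)
       (auto intro!: countable_image countable_L)
  define d where "d z = wp (u + z) - wp (v + eps * z)" for z
  define d1 where "d1 z = wp_deriv (u + z) - eps * wp_deriv (v + eps * z)" for z
  have der: "(d has_field_derivative d1 z) (at z)"
    "(d1 has_field_derivative wp_deriv2 (u + z) - wp_deriv2 (v + eps * z)) (at z)" if "z \<in> S" for z
  proof -
    have z: "u + z \<notin> L" "v + eps * z \<notin> L" using that by (auto simp: S_def)
    have lin: "((\<lambda>z. u + z) has_field_derivative 1) (at z)" "((\<lambda>z. v + eps * z) has_field_derivative eps) (at z)"
      by (auto intro!: derivative_eq_intros)
    have "((\<lambda>z. wp (u + z) - wp (v + eps * z)) has_field_derivative
        wp_deriv (u + z) * 1 - wp_deriv (v + eps * z) * eps) (at z)"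
      by (intro DERIV_diff DERIV_chain2[OF wp_has_derivative] z lin)
    then show "(d has_field_derivative d1 z) (at z)"
      by (simp add: d_def[abs_def] d1_def mult.commute)
    have "((\<lambda>z. wp_deriv (u + z) - eps * wp_deriv (v + eps * z)) has_field_derivative
        wp_deriv2 (u + z) * 1 - eps * (wp_deriv2 (v + eps * z) * eps)) (at z)"
      by (intro DERIV_diff DERIV_cmult DERIV_chain2[OF wp_deriv_has_derivative] z lin)
    moreover have "eps * (wp_deriv2 (v + eps * z) * eps) = (eps * eps) * wp_deriv2 (v + eps * z)"
      by (simp add: mult_ac)
    ultimately show "(d1 has_field_derivative wp_deriv2 (u + z) - wp_deriv2 (v + eps * z)) (at z)"
      by (simp add: d1_def[abs_def] eps2)
  qed
  have d0: "d z = 0" if z: "z \<in> S" for z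
  \<comment> \<open>In the difference of the two equations the constant 30 G4 cancels and 6 y1^2 - 6
    y2^2 = 6 (y1 + y2) (y1 - y2), so the nonlinear equation becomes linear in d with a known
    coefficient.\<close>
  proof (rule linear_ode_unique[where d = d and z = z and q = "\<lambda>z. 6 * (wp (u + z) + wp (v + eps * z))" and S = S and ?z0.0 = 0])
    show "d holomorphic_on S" using der(1) by (auto simp: holomorphic_on_open[OF openS])
    have "(wp \<circ> (\<lambda>z. u + z)) holomorphic_on S"
      by (rule holomorphic_on_compose_gen[OF _ wp_holomorphic]) (auto intro!: holomorphic_intros simp: S_def)
    moreover have "(wp \<circ> (\<lambda>z. v + eps * z)) holomorphic_on S"
      by (rule holomorphic_on_compose_gen[OF _ wp_holomorphic]) (auto intro!: holomorphic_intros simp: S_def)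
    ultimately show "(\<lambda>z. 6 * (wp (u + z) + wp (v + eps * z))) holomorphic_on S"
      by (intro holomorphic_intros) (simp_all add: o_def)
    show "deriv (deriv d) x = 6 * (wp (u + x) + wp (v + eps * x)) * d x" if x: "x \<in> S" for x
    proof -
      have "deriv (deriv d) x = deriv d1 x"
        using der(1) by (intro deriv_cong_ev eventually_mono[OF eventually_nhds_in_open[OF openS x]])
          (auto simp: DERIV_imp_deriv)
      also have "\<dots> = wp_deriv2 (u + x) - wp_deriv2 (v + eps * x)"
        using der(2)[OF x] by (rule DERIV_imp_deriv)
      also have "\<dots> = 6 * (wp (u + x) + wp (v + eps * x)) * d x"
        using x by (simp add: wp_ode2 S_def d_def algebra_simps power2_eq_square)
      finally show ?thesis .
    qed
    show "0 \<in> S" using u v by (simp add: S_def)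
    then show "deriv d 0 = 0" using der(1)[of 0] eq' by (simp add: DERIV_imp_deriv d1_def)
    show "d 0 = 0" using eq by (simp add: d_def)
  qed (use z openS connS in auto)
  have "v + eps * (- u) \<notin> L" using not by simp
  then have lim: "((\<lambda>z. wp (v + eps * z)) \<longlongrightarrow> wp (v + eps * (- u))) (at (- u))"
    by (intro isCont_tendsto_compose[OF DERIV_isCont[OF wp_has_derivative]] tendsto_intros)
  have "filterlim (\<lambda>z. u + z) (at 0) (at (- u))"
    by (auto simp: filterlim_at eventually_at_filter intro!: tendsto_eq_intros) (simp add: add_eq_0_iff)
  then have inf: "filterlim (\<lambda>z. wp (u + z)) at_infinity (at (- u))"
    by (rule filterlim_compose[OF wp_at_infinity])
  have "\<forall>\<^sub>F z in at (- u). u + z \<notin> L"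
    unfolding eventually_at
  proof (intro exI[of _ gap] conjI ballI impI)
    fix z :: complex assume z: "z \<noteq> - u \<and> dist z (- u) < gap"
    then have "u + z \<noteq> 0" by (metis add_eq_0_iff)
    then show "u + z \<notin> L" using z L_norm_ge[of "u + z"] by (auto simp: dist_norm add.commute)
  qed (use gap_pos in auto)
  moreover have "open {z. v + eps * z \<notin> L}"
  proof -
    have "open ((\<lambda>z. v + eps * z) -` (- L))"
      by (intro open_vimage open_compl_L continuous_intros)
    then show ?thesis by (simp add: vimage_def)
  qed
  then have "\<forall>\<^sub>F z in at (- u). z \<in> {z. v + eps * z \<notin> L}"
    by (intro eventually_at_in_open') (use not in auto)
  ultimately have "\<forall>\<^sub>F z in at (- u). wp (u + z) = wp (v + eps * z)"
  proof eventually_elim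
    fix z assume "u + z \<notin> L" "z \<in> {z. v + eps * z \<notin> L}"
    then show "wp (u + z) = wp (v + eps * z)" using d0[of z] by (simp add: S_def d_def)
  qed
  then have "filterlim (\<lambda>z. wp (v + eps * z)) at_infinity (at (- u))"
    using inf by (simp add: filterlim_cong[OF refl refl])
  with lim show False
    using not_tendsto_and_filterlim_at_infinity[of "at (- u)"] by auto
qed

end

section \<open>Half-periods and invariants\<close>

lemma complete_period_commute: "complete_period a b = complete_period b a"
  by (simp add: complete_period_def incomplete_period_def mult.commute)

text \<open>Vieta's formulas, obtained by subtracting the equations and dividing by differences of
  roots. They turn three distinct half-period values, or three zeros found by the intermediate value
  theorem, into a full factorisation.\<close>

lemma depressed_cubic_coeffs:
  fixes x y z a b :: real
  assumes "x \<noteq> y" "x \<noteq> z" "y \<noteq> z"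
    and x: "4 * x ^ 3 - a * x - b = 0" and y: "4 * y ^ 3 - a * y - b = 0" and z: "4 * z ^ 3 - a * z - b = 0"
  shows "x + y + z = 0" "a = - 4 * (x * y + x * z + y * z)" "b = 4 * x * y * z"
proof -
  have "(x - y) * (4 * (x * x + x * y + y * y) - a) = 0" using x y by algebra
  then have xy: "4 * (x * x + x * y + y * y) = a" using assms by simp
  have "(x - z) * (4 * (x * x + x * z + z * z) - a) = 0" using x z by algebra
  then have xz: "4 * (x * x + x * z + z * z) = a" using assms by simp
  have "(y - z) * (x + y + z) = (x * x + x * y + y * y) - (x * x + x * z + z * z)"
    by (simp add: algebra_simps)
  also have "\<dots> = 0" using xy xz by argo
  finally show sum: "x + y + z = 0" using assms by simp
  then show a: "a = - 4 * (x * y + x * z + y * z)" using xy by algebra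
  show "b = 4 * x * y * z" using a sum x by algebra
qed

lemma sorted_roots_unique:
  fixes e1 e2 e3 f1 f2 f3 :: real
  assumes e: "e3 < e2" "e2 < e1" and f: "f3 < f2" "f2 < f1"
    and sym: "e1 + e2 + e3 = f1 + f2 + f3" "e1 * e2 + e1 * e3 + e2 * e3 = f1 * f2 + f1 * f3 + f2 * f3"
      "e1 * e2 * e3 = f1 * f2 * f3"
  shows "e1 = f1" "e2 = f2" "e3 = f3"
proof -
  have "(x - f1) * (x - f2) * (x - f3) = (x - e1) * (x - e2) * (x - e3)" for x
    using sym by algebra
  from this[of e1] this[of e2] this[of e3]
  have d1: "e1 = f1 \<or> e1 = f2 \<or> e1 = f3" and d2: "e2 = f1 \<or> e2 = f2 \<or> e2 = f3"
    and d3: "e3 = f1 \<or> e3 = f2 \<or> e3 = f3"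
    by auto
  have "f3 \<le> e3" using d3 f by auto
  then have "f2 \<le> e2" using d2 e f by auto
  then show 1: "e1 = f1" using d1 e f by auto
  show 2: "e2 = f2" using d2 e f 1 \<open>f2 \<le> e2\<close> by linarith
  show "e3 = f3" using d3 e f 1 2 by linarith
qed

context rect_lattice
begin

lemma half_lattice_iff: "Complex (A * of_int i) (B * of_int j) \<in> L \<longleftrightarrow> even i \<and> even j"
proof -
  have "A * of_int i = 2 * A * of_int m \<longleftrightarrow> i = 2 * m" for m
  proof -
    have "2 * A * of_int m = A * real_of_int (2 * m)" by simp
    then show ?thesis using A_pos by (simp only: mult_cancel_left of_int_eq_iff) simp
  qed
  moreover have "B * of_int j = 2 * B * of_int n \<longleftrightarrow> j = 2 * n" for n
  proof -
    have "2 * B * of_int n = B * real_of_int (2 * n)" by simp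
    then show ?thesis using B_pos by (simp only: mult_cancel_left of_int_eq_iff) simp
  qed
  ultimately show ?thesis by (auto simp: Complex_in_L_iff elim!: evenE)
qed

lemma E_cnj: "E k (cnj z) = cnj (E k z)"
proof -
  have "E k (cnj z) = (\<Sum>\<^sub>\<infinity>w\<in>L - {0}. cnj (1 / (z - w) ^ k))"
    unfolding E_def by (rule infsum_reindex_bij_witness[of _ cnj cnj]) auto
  then show ?thesis by (simp only: E_def infsum_cnj)
qed

lemma wp_deriv_cnj: "wp_deriv (cnj z) = cnj (wp_deriv z)"
  by (simp add: wp_deriv_def E_cnj)

lemma G_real: "cnj G4 = G4" "cnj G6 = G6"
  using E_cnj[of 4 0] E_cnj[of 6 0] by (simp_all add: E_at_0)

text \<open>Modulo L the point w equals both - w and its conjugate. The first makes the odd function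
  \<open>wp_deriv\<close> vanish there, the second makes the value real; the differential equation
  then says that the value is a root of the cubic.\<close>

lemma wp_half_period:
  assumes w: "w = Complex (A * of_int i) (B * of_int j)" "w \<notin> L"
  shows "wp_deriv w = 0" "wp w = complex_of_real (Re (wp w))"
    "4 * Re (wp w) ^ 3 - Re (60 * G4) * Re (wp w) - Re (140 * G6) = 0"
proof -
  have "w + w \<in> L"
    using half_lattice_iff[of "2 * i" "2 * j"] by (simp add: w complex_add algebra_simps)
  then have "wp_deriv w = - wp_deriv w"
    using wp_deriv_periodic[of "- w" "w + w"] w by (simp add: wp_deriv_odd)
  then show d: "wp_deriv w = 0" by simp
  have "cnj w - w \<in> L"
    using half_lattice_iff[of 0 "- 2 * j"] by (simp add: w complex_diff complex_cnj algebra_simps)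
  then have "cnj (wp w) = wp w"
    using wp_periodic[of w "cnj w - w"] w by (simp add: wp_cnj)
  then show r: "wp w = complex_of_real (Re (wp w))" by (simp add: complex_eq_iff)
  have "Im G4 = 0" "Im G6 = 0" using G_real by (auto simp: complex_eq_iff)
  moreover have "Im (wp w) = 0" using r by (metis Im_complex_of_real)
  ultimately show "4 * Re (wp w) ^ 3 - Re (60 * G4) * Re (wp w) - Re (140 * G6) = 0"
    using arg_cong[OF wp_ode[OF w(2)], of Re] d by (simp add: power3_eq_cube)
qed

text \<open>Both derivatives are 0, so equal values would give v - u \<in> L by
  \<open>wp_eq_imp\<close>, which the parity condition excludes.\<close>

lemma half_periods_wp_neq:
  assumes u: "u = Complex (A * of_int i) (B * of_int j)" "u \<notin> L"
    and v: "v = Complex (A * of_int i') (B * of_int j')" "v \<notin> L"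
    and ne: "odd (i' - i) \<or> odd (j' - j)"
  shows "Re (wp u) \<noteq> Re (wp v)"
proof
  assume "Re (wp u) = Re (wp v)"
  then have "wp u = wp v" using wp_half_period(2)[OF u] wp_half_period(2)[OF v] by metis
  then have "v - 1 * u \<in> L"
    using wp_half_period(1)[OF u] wp_half_period(1)[OF v] u v by (intro wp_eq_imp) auto
  then have "Complex (A * of_int (i' - i)) (B * of_int (j' - j)) \<in> L"
    by (simp add: u v complex_diff algebra_simps)
  then show False using ne by (simp only: half_lattice_iff) auto
qed

lemma real_notin_L:
  assumes "0 < t" "t < 2 * A"
  shows "complex_of_real t \<notin> L"
proof
  assume "complex_of_real t \<in> L"
  then obtain m :: int where m: "t = 2 * A * m" by (auto simp: L_iff)
  then have "0 < real_of_int m" "real_of_int m < 1" using assms A_pos by (simp_all add: zero_less_mult_iff)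
  then have "0 < m" "m < 1" by simp_all
  then show False by simp
qed

text \<open>The three half-period values are distinct roots, so they factor the cubic. On (0, A) the
  Weierstrass function is real and decreasing, and \<open>complete_period_eqI\<close> with G the
  identity returns the length A of the interval.\<close>

lemma real_half_period:
  "\<exists>e1 e2 e3. e3 < e2 \<and> e2 < e1 \<and> e1 + e2 + e3 = 0 \<and>
     lattice_g2 L = complex_of_real (- 4 * (e1 * e2 + e1 * e3 + e2 * e3)) \<and>
     lattice_g3 L = complex_of_real (4 * e1 * e2 * e3) \<and>
     complete_period (e1 - e2) (e1 - e3) = A"
proof -
  define w1 where "w1 = Complex (A * of_int 1) (B * of_int 0)"
  define w2 where "w2 = Complex (A * of_int 0) (B * of_int 1)"
  define w3 where "w3 = Complex (A * of_int 1) (B * of_int 1)"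
  have notin: "w1 \<notin> L" "w2 \<notin> L" "w3 \<notin> L"
    unfolding w1_def w2_def w3_def half_lattice_iff by auto
  define e1 where "e1 = Re (wp w1)"
  define e2 where "e2 = Re (wp w2)"
  define e3 where "e3 = Re (wp w3)"
  note hp = wp_half_period[OF w1_def notin(1)] wp_half_period[OF w2_def notin(2)] wp_half_period[OF w3_def notin(3)]
  have ne: "e1 \<noteq> e2" "e1 \<noteq> e3" "e2 \<noteq> e3"
    unfolding e1_def e2_def e3_def
    by (rule half_periods_wp_neq[OF w1_def notin(1) w2_def notin(2)]
             half_periods_wp_neq[OF w1_def notin(1) w3_def notin(3)]
             half_periods_wp_neq[OF w2_def notin(2) w3_def notin(3)]; simp)+
  define a2 where "a2 = Re (60 * G4)"
  define a3 where "a3 = Re (140 * G6)"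
  note coeffs = depressed_cubic_coeffs[OF ne hp(3,6,9)[folded e1_def e2_def e3_def a2_def a3_def]]
  have imG: "Im G4 = 0" "Im G6 = 0" using G_real by (auto simp: complex_eq_iff)
  have g: "lattice_g2 L = complex_of_real a2" "lattice_g3 L = complex_of_real a3"
    using imG by (simp_all add: lattice_g2_def lattice_g3_def a2_def a3_def complex_eq_iff flip: G4_def G6_def)
  define X where "X t = Re (wp (complex_of_real t))" for t
  define D where "D t = Re (wp_deriv (complex_of_real t))" for t
  have tL: "complex_of_real t \<notin> L" if "0 < t" "t < 2 * A" for t
    using real_notin_L[OF that] .
  have im: "Im (wp (complex_of_real t)) = 0" "Im (wp_deriv (complex_of_real t)) = 0" for t
    using wp_cnj[of "complex_of_real t"] wp_deriv_cnj[of "complex_of_real t"] by (simp_all add: complex_eq_iff)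
  have Xder: "(X has_real_derivative D t) (at t)" if "0 < t" "t < 2 * A" for t
    using bounded_linear.has_vector_derivative[OF bounded_linear_Re
        has_vector_derivative_real_field[OF wp_has_derivative[OF tL[OF that]], of UNIV]]
    unfolding X_def[abs_def] D_def has_real_derivative_iff_has_vector_derivative by simp
  have Dder: "(D has_real_derivative Re (wp_deriv2 (complex_of_real t))) (at t)" if "0 < t" "t < 2 * A" for t
    using bounded_linear.has_vector_derivative[OF bounded_linear_Re
        has_vector_derivative_real_field[OF wp_deriv_has_derivative[OF tL[OF that]], of UNIV]]
    unfolding D_def[abs_def] has_real_derivative_iff_has_vector_derivative by simp
  have ode: "(D t)\<^sup>2 = 4 * (X t - e1) * (X t - e2) * (X t - e3)" if t: "0 < t" "t < 2 * A" for t
  proof -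
    have "(D t)\<^sup>2 = 4 * X t ^ 3 - a2 * X t - a3"
      using arg_cong[OF wp_ode[OF tL[OF t]], of Re] im imG
      by (simp add: D_def X_def a2_def a3_def power3_eq_cube power2_eq_square)
    then show ?thesis using coeffs by algebra
  qed
  \<comment> \<open>At a zero of the derivative, wp' = - wp', so \<open>wp_eq_imp\<close> with u = v
    = t and sign -1 puts 2 t into L, although 0 < 2 t < 2 A.\<close>
  have D_ne: "D t \<noteq> 0" if t: "0 < t" "t < A" for t
  proof
    assume "D t = 0"
    then have "wp_deriv (complex_of_real t) = 0" using im by (simp add: D_def complex_eq_iff)
    then have "complex_of_real t - (-1) * complex_of_real t \<in> L"
      using tL[of t] t by (intro wp_eq_imp) auto
    then have "complex_of_real (2 * t) \<in> L" by simp
    then show False using real_notin_L[of "2 * t"] t by simp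
  qed
  have lim0: "filterlim X at_top (at_right 0)"
  proof -
    have t0: "filterlim complex_of_real (at 0) (at_right 0)"
      by (auto simp: filterlim_at eventually_at_filter intro!: tendsto_eq_intros)
    have "((\<lambda>t. Re (wp_reg (complex_of_real t))) \<longlongrightarrow> Re 0) (at_right 0)"
      by (intro tendsto_Re filterlim_compose[OF wp_reg_tendsto t0])
    moreover have "filterlim (\<lambda>t::real. inverse (t ^ 2)) at_top (at_right 0)"
      by (rule filterlim_compose[OF filterlim_inverse_at_top_right])
         (auto simp: filterlim_at eventually_at_filter intro!: tendsto_eq_intros)
    ultimately have "filterlim (\<lambda>t. Re (wp_reg (complex_of_real t)) + inverse (t ^ 2)) at_top (at_right 0)"
      by (rule filterlim_tendsto_add_at_top)
    moreover have "X t = Re (wp_reg (complex_of_real t)) + inverse (t ^ 2)" for t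
      by (simp add: X_def wp_eq divide_inverse flip: of_real_power of_real_inverse)
    ultimately show ?thesis by presburger
  qed
  \<comment> \<open>A positive value at t would, as D has no zero, make D positive on all of (0, t];
    then X would increase there, against its blow-up at 0.\<close>
  have D_neg: "D t < 0" if t: "0 < t" "t < A" for t
  proof (rule ccontr)
    assume "\<not> D t < 0"
    then have Dt: "0 < D t" using D_ne[OF t] by simp
    have Dpos: "0 < D s" if s: "0 < s" "s \<le> t" for s
    proof (rule ccontr)
      assume "\<not> 0 < D s"
      then have "D s \<le> 0" by simp
      then have "\<exists>x\<ge>s. x \<le> t \<and> D x = 0"
      proof (rule IVT)
        show "\<forall>x. s \<le> x \<and> x \<le> t \<longrightarrow> isCont D x"
          using s t A_pos by (auto intro!: DERIV_isCont[OF Dder])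
      qed (use Dt s in auto)
      then show False using D_ne s t by force
    qed
    have "\<forall>\<^sub>F s in at_right 0. X t + 1 \<le> X s \<and> s \<in> {0<..<t}"
      using filterlim_at_top[THEN iffD1, OF lim0, rule_format, of "X t + 1"] eventually_at_right_real[OF t(1)]
      by eventually_elim auto
    then obtain s where s: "X t + 1 \<le> X s" "0 < s" "s < t"
      using eventually_happens'[of "at_right (0::real)"] by force
    have "X s < X t"
    proof (rule DERIV_pos_imp_increasing[OF s(3)])
      show "\<exists>y. (X has_real_derivative y) (at x) \<and> 0 < y" if "s \<le> x" "x \<le> t" for x
        using Xder[of x] Dpos[of x] that s t A_pos by (intro exI[of _ "D x"]) auto
    qed
    with s show False by simp
  qed
  have limA: "(X \<longlongrightarrow> e1) (at_left A)"
  proof -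
    have "w1 = complex_of_real A" by (simp add: w1_def complex_eq_iff)
    then have "isCont X A" "X A = e1"
      using A_pos by (auto intro!: DERIV_isCont[OF Xder] simp: X_def e1_def)
    then show ?thesis
      unfolding isCont_def by (metis subset_UNIV tendsto_within_subset)
  qed
  note period = complete_period_eqI[where X = X and D = D and g = "\<lambda>_. 1" and G = "\<lambda>t. t", OF A_pos]
  have ode': "(D t)\<^sup>2 = 1\<^sup>2 * (4 * (X t - e1) * (X t - e2) * (X t - e3))" if "0 < t" "t < A" for t
    using ode[of t] that by simp
  have "e2 < e1" "e3 < e1" "complete_period (e1 - e2) (e1 - e3) = A - 0"
    by (rule period[OF Xder D_neg ode' _ _ _ lim0 limA ne(1,2)]; use A_pos in \<open>auto intro!: derivative_eq_intros\<close>)+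
  \<comment> \<open>The criterion puts e1 on top but does not order the values at iB and A + iB.
    They are named by size, which is harmless because the complete period is symmetric in its
    arguments.\<close>
  then show ?thesis
  proof (cases "e3 < e2")
    case True
    then show ?thesis
      using \<open>e2 < e1\<close> \<open>complete_period (e1 - e2) (e1 - e3) = A - 0\<close> g coeffs
      by (intro exI[of _ e1] exI[of _ e2] exI[of _ e3]) simp
  next
    case False
    then have "e2 < e3" using ne by simp
    then show ?thesis
      using \<open>e3 < e1\<close> \<open>complete_period (e1 - e2) (e1 - e3) = A - 0\<close> g coeffs
      by (intro exI[of _ e1] exI[of _ e3] exI[of _ e2]) (simp add: complete_period_commute algebra_simps)
  qed
qed

end

text \<open>Multiplication by i maps one lattice onto the other, and i^4 = 1 while i^6 = -1.\<close>

lemma rect_lattice_rotate: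
  assumes "0 < A" "0 < B"
  shows "lattice_g2 (rect_lattice.L B A) = lattice_g2 (rect_lattice.L A B)"
    and "lattice_g3 (rect_lattice.L B A) = - lattice_g3 (rect_lattice.L A B)"
proof -
  interpret P: rect_lattice A B using assms by unfold_locales
  interpret Q: rect_lattice B A using assms by unfold_locales
  have rot: "\<i> * z \<in> Q.L" if z: "z \<in> P.L" for z
  proof -
    obtain m n :: int where "Re z = 2 * A * m" "Im z = 2 * B * n"
      using z by (auto simp: P.L_iff)
    then show ?thesis unfolding Q.L_iff by (intro exI[of _ "- n"] exI[of _ m]) simp
  qed
  have rot': "- \<i> * z \<in> P.L" if z: "z \<in> Q.L" for z
  proof -
    obtain m n :: int where "Re z = 2 * B * m" "Im z = 2 * A * n"
      using z by (auto simp: Q.L_iff)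
    then show ?thesis unfolding P.L_iff by (intro exI[of _ n] exI[of _ "- m"]) simp
  qed
  have reindex: "(\<Sum>\<^sub>\<infinity>w\<in>P.L - {0}. f (\<i> * w)) = (\<Sum>\<^sub>\<infinity>w\<in>Q.L - {0}. f w)" for f :: "complex \<Rightarrow> complex"
    by (rule infsum_reindex_bij_witness[of _ "\<lambda>w. - \<i> * w" "\<lambda>w. \<i> * w"])
       (use rot rot' in \<open>auto simp: mult.assoc[symmetric]\<close>)
  show "lattice_g2 Q.L = lattice_g2 P.L"
    unfolding lattice_g2_def reindex[symmetric] by (simp add: power_mult_distrib)
  have "(\<Sum>\<^sub>\<infinity>w\<in>Q.L - {0}. 1 / w ^ 6) = (\<Sum>\<^sub>\<infinity>w\<in>P.L - {0}. - (1 / w ^ 6))"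
    unfolding reindex[symmetric] by (simp add: power_mult_distrib)
  then show "lattice_g3 Q.L = - lattice_g3 P.L"
    unfolding lattice_g3_def infsum_uminus by simp
qed

text \<open>Negating g3 negates the roots, so the rotated lattice has the ordered roots - e3 > - e2
  > - e1. Its gaps from the top are e2 - e3 and e1 - e3, which are the arguments for B.\<close>

lemma rect_lattice_periods:
  assumes "0 < A" "0 < B"
  defines "L \<equiv> lattice (2 * complex_of_real A) (2 * (\<i> * complex_of_real B))"
  obtains e1 e2 e3 :: real where "e3 < e2" "e2 < e1" "e1 + e2 + e3 = 0"
    "lattice_g2 L = complex_of_real (- 4 * (e1 * e2 + e1 * e3 + e2 * e3))"
    "lattice_g3 L = complex_of_real (4 * e1 * e2 * e3)"
    "complete_period (e1 - e2) (e1 - e3) = A" "complete_period (e2 - e3) (e1 - e3) = B"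
proof -
  interpret P: rect_lattice A B using assms by unfold_locales
  interpret Q: rect_lattice B A using assms by unfold_locales
  have L: "P.L = L" by (simp add: P.L_def L_def)
  obtain e1 e2 e3 where e: "e3 < e2" "e2 < e1" "e1 + e2 + e3 = 0"
    "lattice_g2 L = complex_of_real (- 4 * (e1 * e2 + e1 * e3 + e2 * e3))"
    "lattice_g3 L = complex_of_real (4 * e1 * e2 * e3)"
    "complete_period (e1 - e2) (e1 - e3) = A"
    using P.real_half_period unfolding L by blast
  obtain f1 f2 f3 where f: "f3 < f2" "f2 < f1" "f1 + f2 + f3 = 0"
    "lattice_g2 Q.L = complex_of_real (- 4 * (f1 * f2 + f1 * f3 + f2 * f3))"
    "lattice_g3 Q.L = complex_of_real (4 * f1 * f2 * f3)"
    "complete_period (f1 - f2) (f1 - f3) = B"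
    using Q.real_half_period by blast
  have s2: "- 4 * (f1 * f2 + f1 * f3 + f2 * f3) = - 4 * (e1 * e2 + e1 * e3 + e2 * e3)"
    using rect_lattice_rotate(1)[OF assms(1,2)] unfolding f L e of_real_eq_iff .
  have s3: "4 * f1 * f2 * f3 = - (4 * e1 * e2 * e3)"
    using rect_lattice_rotate(2)[OF assms(1,2)] unfolding f L e of_real_minus[symmetric] of_real_eq_iff .
  have "f1 = - e3" "f2 = - e2" "f3 = - e1"
    by (rule sorted_roots_unique[of f3 f2 f1 "- e1" "- e2" "- e3"]; use e f s2 s3 in \<open>simp add: algebra_simps\<close>)+
  then have "complete_period (e2 - e3) (e1 - e3) = B" using f(6) by simp
  with e show ?thesis by (rule that)
qed

lemma signature_three_cubic_roots:
  fixes k :: real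
  assumes "0 < k" "k < 1"
  obtains e1 e2 e3 :: real where "e3 < e2" "e2 < e1" "e1 + e2 + e3 = 0"
    "48 * (1 + 8 * k) = - 4 * (e1 * e2 + e1 * e3 + e2 * e3)"
    "64 * (1 - 20 * k - 8 * k\<^sup>2) = 4 * e1 * e2 * e3"
proof -
  define p where "p x = 4 * x ^ 3 - 48 * (1 + 8 * k) * x - 64 * (1 - 20 * k - 8 * k\<^sup>2)" for x :: real
  \<comment> \<open>The positive critical point of p is 2 r. The other inner separator, -2, is the
    double root of the cubic at k = 0; the bounds -20 and 20 are crude and enclose all roots for 0 <
    k < 1.\<close>
  define r where "r = sqrt (1 + 8 * k)"
  have r2: "r\<^sup>2 = 1 + 8 * k" using assms by (simp add: r_def)
  have r: "0 < r" "r < 3"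
    using assms real_sqrt_less_mono[of "1 + 8 * k" "3\<^sup>2"] by (simp_all add: r_def)
  have k2: "0 < k\<^sup>2" "k\<^sup>2 < 1" using assms by (simp_all add: power_less_one_iff)
  have cont: "isCont p x" for x unfolding p_def by (intro continuous_intros)
  have "p (- 20) = - 31104 + 8960 * k + 512 * k\<^sup>2" "p (- 2) = 2048 * k + 512 * k\<^sup>2"
    "p 20 = 30976 - 6400 * k + 512 * k\<^sup>2"
    by (simp_all add: p_def)
  then have p1: "p (- 20) < 0" "0 < p (- 2)" "0 < p 20"
    using assms k2 by linarith+
  \<comment> \<open>Up to a positive factor this is the discriminant of the cubic. Its positivity
    says |1 - 20 k - 8 k^2| < r^3, that is, the local minimum at 2 r lies below 0.\<close>
  have "0 < 64 * (k * (1 - k) ^ 3)" using assms by simp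
  also have "64 * (k * (1 - k) ^ 3) = (r\<^sup>2) ^ 3 - (1 - 20 * k - 8 * k\<^sup>2)\<^sup>2"
    unfolding r2 by algebra
  finally have "(1 - 20 * k - 8 * k\<^sup>2)\<^sup>2 < (r ^ 3)\<^sup>2" by (simp flip: power_mult)
  then have "\<bar>1 - 20 * k - 8 * k\<^sup>2\<bar> < r ^ 3"
    using r abs_le_square_iff[of "r ^ 3" "1 - 20 * k - 8 * k\<^sup>2"] by force
  moreover have "p (2 * r) = - 64 * (r ^ 3 + (1 - 20 * k - 8 * k\<^sup>2))"
    unfolding p_def r2[symmetric] by algebra
  ultimately have p2: "p (2 * r) < 0" by simp
  obtain e3 where e3: "- 20 \<le> e3" "e3 \<le> - 2" "p e3 = 0"
    using IVT[of p "- 20" 0 "- 2"] cont p1 by auto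
  obtain e2 where e2: "- 2 \<le> e2" "e2 \<le> 2 * r" "p e2 = 0"
    using IVT2[of p "2 * r" 0 "- 2"] cont p1 p2 r by auto
  obtain e1 where e1: "2 * r \<le> e1" "e1 \<le> 20" "p e1 = 0"
    using IVT[of p "2 * r" 0 20] cont p1 p2 r by auto
  have "e3 \<noteq> - 2" "e2 \<noteq> 2 * r" using e3 e2 p1 p2 by auto
  then have lt: "e3 < e2" "e2 < e1" using e1 e2 e3 by auto
  show ?thesis
    by (rule that[OF lt depressed_cubic_coeffs[OF _ _ _ e1(3)[unfolded p_def] e2(3)[unfolded p_def] e3(3)[unfolded p_def]]])
       (use lt in auto)
qed

theorem theorem8:
  fixes \<kappa> :: real
  assumes "0 < \<kappa>" and "\<kappa> < 1"
  defines "G2 \<equiv> complex_of_real (48 * (1 + 8 * \<kappa>^2))"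
      and "G3 \<equiv> complex_of_real (64 * (1 - 20 * \<kappa>^2 - 8 * \<kappa>^4))"
  shows "(\<exists>\<Omega> \<Omega>' :: complex.
            Im \<Omega> = 0 \<and> Re \<Omega> > 0 \<and> Re \<Omega>' = 0 \<and> Im \<Omega>' > 0 \<and>
            lattice_g2 (lattice (2 * \<Omega>) (2 * \<Omega>')) = G2 \<and>
            lattice_g3 (lattice (2 * \<Omega>) (2 * \<Omega>')) = G3)
       \<and> (\<forall>\<Omega> \<Omega>' :: complex.
            Im \<Omega> = 0 \<and> Re \<Omega> > 0 \<and> Re \<Omega>' = 0 \<and> Im \<Omega>' > 0 \<and>
            lattice_g2 (lattice (2 * \<Omega>) (2 * \<Omega>')) = G2 \<and>
            lattice_g3 (lattice (2 * \<Omega>) (2 * \<Omega>')) = G3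
            \<longrightarrow> \<Omega> = complex_of_real
                  (1 / (2 * sqrt 6) * pi * hyp2F1 (1/3) (2/3) 1 (\<kappa>^2)))"
proof (intro conjI allI impI)
  have k: "0 < \<kappa>\<^sup>2" "\<kappa>\<^sup>2 < 1" using assms(1,2) by (simp_all add: power_less_one_iff)
  have k4: "\<kappa> ^ 4 = (\<kappa>\<^sup>2)\<^sup>2" by simp
  show "\<exists>\<Omega> \<Omega>' :: complex.
            Im \<Omega> = 0 \<and> Re \<Omega> > 0 \<and> Re \<Omega>' = 0 \<and> Im \<Omega>' > 0 \<and>
            lattice_g2 (lattice (2 * \<Omega>) (2 * \<Omega>')) = G2 \<and>
            lattice_g3 (lattice (2 * \<Omega>) (2 * \<Omega>')) = G3"
  proof -
    obtain e1 e2 e3 :: real where e: "e3 < e2" "e2 < e1" "e1 + e2 + e3 = 0"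
      and g2: "48 * (1 + 8 * \<kappa>\<^sup>2) = - 4 * (e1 * e2 + e1 * e3 + e2 * e3)"
      and g3: "64 * (1 - 20 * \<kappa>\<^sup>2 - 8 * (\<kappa>\<^sup>2)\<^sup>2) = 4 * e1 * e2 * e3"
      using signature_three_cubic_roots[OF k] by metis
    define A where "A = complete_period (e1 - e2) (e1 - e3)"
    define B where "B = complete_period (e2 - e3) (e1 - e3)"
    have AB: "0 < A" "0 < B" using e by (auto simp: A_def B_def intro!: complete_period_pos)
    obtain f1 f2 f3 :: real where f: "f3 < f2" "f2 < f1" "f1 + f2 + f3 = 0"
      and g: "lattice_g2 (lattice (2 * complex_of_real A) (2 * (\<i> * complex_of_real B))) = complex_of_real (- 4 * (f1 * f2 + f1 * f3 + f2 * f3))"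
        "lattice_g3 (lattice (2 * complex_of_real A) (2 * (\<i> * complex_of_real B))) = complex_of_real (4 * f1 * f2 * f3)"
      and per: "complete_period (f1 - f2) (f1 - f3) = A" "complete_period (f2 - f3) (f1 - f3) = B"
      using rect_lattice_periods[OF AB] by metis
    have "f1 - f2 = e1 - e2" "f1 - f3 = e1 - e3"
      by (rule complete_period_pair_inj[of "f1 - f2" "f1 - f3" "e1 - e2" "e1 - e3"];
          use e f per in \<open>simp add: A_def B_def\<close>)+
    \<comment> \<open>The pair of periods fixes only differences of roots; the vanishing sums fix
      the roots themselves.\<close>
    then have "f1 = e1" "f2 = e2" "f3 = e3" using e(3) f(3) by linarith+
    then show ?thesis
      using AB g g2 g3 unfolding G2_def G3_def k4
      by (intro exI[of _ "complex_of_real A"] exI[of _ "\<i> * complex_of_real B"]) simp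
  qed
  fix \<Omega> \<Omega>' :: complex
  assume *: "Im \<Omega> = 0 \<and> Re \<Omega> > 0 \<and> Re \<Omega>' = 0 \<and> Im \<Omega>' > 0 \<and>
            lattice_g2 (lattice (2 * \<Omega>) (2 * \<Omega>')) = G2 \<and>
            lattice_g3 (lattice (2 * \<Omega>) (2 * \<Omega>')) = G3"
  define A where "A = Re \<Omega>"
  define B where "B = Im \<Omega>'"
  have AB: "0 < A" "0 < B" and \<Omega>: "\<Omega> = complex_of_real A" "\<Omega>' = \<i> * complex_of_real B"
    using * by (simp_all add: A_def B_def complex_eq_iff)
  obtain e1 e2 e3 :: real where e: "e3 < e2" "e2 < e1" "e1 + e2 + e3 = 0"
    and g: "lattice_g2 (lattice (2 * \<Omega>) (2 * \<Omega>')) = complex_of_real (- 4 * (e1 * e2 + e1 * e3 + e2 * e3))"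
      "lattice_g3 (lattice (2 * \<Omega>) (2 * \<Omega>')) = complex_of_real (4 * e1 * e2 * e3)"
    and per: "complete_period (e1 - e2) (e1 - e3) = A"
    using rect_lattice_periods[OF AB] unfolding \<Omega> by metis
  have "complex_of_real (48 * (1 + 8 * \<kappa>\<^sup>2)) = complex_of_real (- 4 * (e1 * e2 + e1 * e3 + e2 * e3))"
    "complex_of_real (64 * (1 - 20 * \<kappa>\<^sup>2 - 8 * \<kappa> ^ 4)) = complex_of_real (4 * e1 * e2 * e3)"
    using * g by (simp_all only: G2_def G3_def)
  then have g': "48 * (1 + 8 * \<kappa>\<^sup>2) = - 4 * (e1 * e2 + e1 * e3 + e2 * e3)"
    "64 * (1 - 20 * \<kappa>\<^sup>2 - 8 * \<kappa> ^ 4) = 4 * e1 * e2 * e3"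
    by (simp_all only: of_real_eq_iff)
  have "4 * x ^ 3 - 48 * (1 + 8 * \<kappa>\<^sup>2) * x - 64 * (1 - 20 * \<kappa>\<^sup>2 - 8 * \<kappa> ^ 4)
      = 4 * (x - e1) * (x - e2) * (x - e3)" for x
    unfolding g' using e(3) by algebra
  from complete_period_signature_three[OF assms(1,2) e(1,2) this] per
  show "\<Omega> = complex_of_real (1 / (2 * sqrt 6) * pi * hyp2F1 (1/3) (2/3) 1 (\<kappa>^2))"
    unfolding \<Omega>(1) by simp
qed

end
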